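(* For every constant $C>0$ there is a polynomial $q$ such that for all integers $m\ge2$, $k\ge 1$ and $n\ge 1$ with $n\le C\log_2 m$ there is a deterministic (not necessarily truthful) $n$-player communication protocol of cost at most $q(m,k)$ bits that, for bidders whose valuations over $m$ items have precision $k$ and are each either subadditive or single-minded, always outputs an allocation guaranteeing a $\frac12$-approximation to the optimal social welfare.
   Context: There are $m$ items $[m]=\{1,\dots,m\}$ and $n$ bidders. A valuation is a function $v:2^{[m]}\to\mathbb R$ that is monotone ($v(S)\le v(T)$ for $S\subseteq T$) and normalized ($v(\emptyset)=0$). It has precision $k$ if all its values lie in $\{0\}\cup\{x/2^k : x\in\{1,\dots,2^{2k}\}\}$. It is subadditive if $v(S\cup T)\le v(S)+v(T)$ for all $S,T\subseteq[m]$. It is single-minded if there are $w\ge 0$ and $T\subseteq[m]$ with $v(S)=w$ when $S\supseteq T$ and $v(S)=0$ otherwise. An allocation is a tuple $(A_1,\dots,A_n)$ of pairwise disjoint subsets of $[m]$; its social welfare is $\sum_i v_i(A_i)$. The protocol guarantees a $\frac12$-approximation if on every valuation profile the welfare of its output is at least half of the maximum welfare over all allocations. Communication is in the $n$-player deterministic number-in-hand blackboard model: player $i$ knows only $v_i$, all messages are visible to all players, and the transcript determines the output. The cost of a protocol is the maximum number of bits written. *)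

theory Defs
  imports
    Complex_Main
    "HOL-Library.FuncSet"
    "HOL-Library.Disjoint_Sets"
    "HOL-Computational_Algebra.Polynomial"
begin

section \<open>Combinatorial auctions\<close>

abbreviation items :: "nat \<Rightarrow> nat set" where
  "items m \<equiv> {1..m}"

abbreviation bidders :: "nat \<Rightarrow> nat set" where
  "bidders n \<equiv> {1..n}"

text \<open>Functions on \<open>2\<^sup>[\<^sup>m\<^sup>]\<close> and tuples indexed by \<open>[n]\<close> are represented by extensional
  functions, so that they carry no information outside their domain.\<close>

type_synonym valuation = "nat set \<Rightarrow> real"

definition is_valuation :: "nat \<Rightarrow> valuation \<Rightarrow> bool" where
  "is_valuation m v \<longleftrightarrow>
     v \<in> extensional (Pow (items m)) \<and>
     mono_on (Pow (items m)) v \<and>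
     v {} = 0"

definition has_precision :: "nat \<Rightarrow> nat \<Rightarrow> valuation \<Rightarrow> bool" where
  "has_precision m k v \<longleftrightarrow>
     (\<forall>S \<subseteq> items m. v S \<in> {0} \<union> {real x / 2 ^ k | x. x \<in> {1..2 ^ (2 * k)}})"

definition subadditive :: "nat \<Rightarrow> valuation \<Rightarrow> bool" where
  "subadditive m v \<longleftrightarrow>
     (\<forall>S \<subseteq> items m. \<forall>T \<subseteq> items m. v (S \<union> T) \<le> v S + v T)"

definition single_minded :: "nat \<Rightarrow> valuation \<Rightarrow> bool" where
  "single_minded m v \<longleftrightarrow>
     (\<exists>w \<ge> 0. \<exists>T \<subseteq> items m. \<forall>S \<subseteq> items m. v S = (if T \<subseteq> S then w else 0))"

definition subadditive_or_single_minded :: "nat \<Rightarrow> nat \<Rightarrow> valuation set" where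
  "subadditive_or_single_minded m k =
     {v. is_valuation m v \<and> has_precision m k v \<and> (subadditive m v \<or> single_minded m v)}"

definition profiles :: "nat \<Rightarrow> valuation set \<Rightarrow> (nat \<Rightarrow> valuation) set" where
  "profiles n V = (bidders n \<rightarrow>\<^sub>E V)"

definition allocations :: "nat \<Rightarrow> nat \<Rightarrow> (nat \<Rightarrow> nat set) set" where
  "allocations n m =
     {A \<in> bidders n \<rightarrow>\<^sub>E Pow (items m). disjoint_family_on A (bidders n)}"

definition welfare :: "nat \<Rightarrow> (nat \<Rightarrow> valuation) \<Rightarrow> (nat \<Rightarrow> nat set) \<Rightarrow> real" where
  "welfare n v A = (\<Sum>i\<in>bidders n. v i (A i))"

definition opt_welfare :: "nat \<Rightarrow> nat \<Rightarrow> (nat \<Rightarrow> valuation) \<Rightarrow> real" where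
  "opt_welfare n m v = Max (welfare n v ` allocations n m)"

section \<open>Deterministic number-in-hand blackboard protocols\<close>

text \<open>A protocol is a binary tree whose nodes are the possible contents of the blackboard.
  At \<open>Speak i f P0 P1\<close> player \<open>i\<close> writes the bit \<open>f x\<close> computed from her private input \<open>x\<close>,
  and the protocol continues with \<open>P1\<close> or \<open>P0\<close> according to this bit.\<close>

datatype ('x, 'o) protocol =
    Output 'o
  | Speak nat "'x \<Rightarrow> bool" "('x, 'o) protocol" "('x, 'o) protocol"

primrec speakers :: "('x, 'o) protocol \<Rightarrow> nat set" where
  "speakers (Output a) = {}"
| "speakers (Speak i f P0 P1) = insert i (speakers P0 \<union> speakers P1)"

primrec outcome :: "('x, 'o) protocol \<Rightarrow> (nat \<Rightarrow> 'x) \<Rightarrow> 'o" where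
  "outcome (Output a) v = a"
| "outcome (Speak i f P0 P1) v = (if f (v i) then outcome P1 v else outcome P0 v)"

primrec transcript :: "('x, 'o) protocol \<Rightarrow> (nat \<Rightarrow> 'x) \<Rightarrow> bool list" where
  "transcript (Output a) v = []"
| "transcript (Speak i f P0 P1) v =
     f (v i) # (if f (v i) then transcript P1 v else transcript P0 v)"

definition cost :: "('x, 'o) protocol \<Rightarrow> (nat \<Rightarrow> 'x) set \<Rightarrow> nat" where
  "cost P D = Max ((\<lambda>v. length (transcript P v)) ` D)"

definition half_approximates ::
    "nat \<Rightarrow> nat \<Rightarrow> (valuation, nat \<Rightarrow> nat set) protocol \<Rightarrow> (nat \<Rightarrow> valuation) set \<Rightarrow> bool" where
  "half_approximates n m P D \<longleftrightarrow>
     (\<forall>v\<in>D. outcome P v \<in> allocations n m \<and>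
             welfare n v (outcome P v) \<ge> 1 / 2 * opt_welfare n m v)"

section \<open>Bivariate polynomials\<close>

text \<open>The inner indeterminate is evaluated at \<open>x\<close>, the outer one at \<open>y\<close>.\<close>

definition eval2 :: "real poly poly \<Rightarrow> real \<Rightarrow> real \<Rightarrow> real" where
  "eval2 q x y = poly (poly q [:y:]) x"

end

theory Submission
  imports Defs
begin

text \<open>For subadditive bidders, every valuation profile admits item prices \<open>p\<close> and utilities \<open>u\<close> with
  \<open>v\<^sub>i(S) \<le> u\<^sub>i + p(S)\<close> whose total is at most twice the optimal welfare plus \<open>\<epsilon>\<close>. They arise, by a
  minimax argument, from an all-pay auction in which a bidder may deviate to a resampled copy of
  the random prices. Rounded to a grid, such price certificates are short. If some allocation has
  welfare at least \<open>t\<close>, then all certificates of total less than \<open>t\<close> are wrong, and a bidder can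
  always refute a \<open>1/n\<close> fraction of the remaining ones by announcing the value of one bundle. Once
  all of them are refuted, every profile consistent with the announcements has an allocation of
  welfare almost \<open>t/2\<close>; by minimax one distribution over allocations achieves this on average for
  all these profiles at once, and the method of conditional expectations extracts an allocation
  from it. Integrality of the scaled valuations absorbs the errors, and \<open>t\<close> is found by binary
  search. Single-minded bidders announce their valuations; as \<open>2\<^sup>n\<close> is polynomial in \<open>m\<close>, all sets of
  winning single-minded bidders can be tried.\<close>

section \<open>A minimax theorem\<close>

text \<open>The pairs of prices and utilities are feasible duals of the configuration linear
  program; bounding their total by twice the optimum is what produces the factor 1/2. Pairwise
  intersecting demands give single-minded bidders larger gaps, which is why they are split off.

  A valuation has \<open>2 ^ m\<close> values, so no subadditive bidder can announce hers.
  Certificates are exponentially many only in a polynomial of the parameters, and shrinking their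
  number by \<open>1 - 1 / n\<close> per round exhausts them after polynomially many rounds. The
  profile is then still largely unknown, so an allocation rule is needed that suits every consistent
  profile. The distribution given by minimax depends on the transcript alone and can be found
  without communication. Only its derandomization needs the bidders again.

  Error budget: the distribution reaches \<open>t/2 - 1/4\<close> on average and the rounded
  conditional expectations lose less than \<open>1/4\<close>, so twice an integral welfare exceeds
  \<open>t - 1\<close> and is therefore at least \<open>t\<close>.\<close>

text \<open>A weight \<open>s\<close> has to satisfy \<open>low b \<le> s\<close> wherever
  \<open>g b < c\<close>, and \<open>s \<le> up a\<close> wherever \<open>f a < c\<close>. Two
  clashing constraints would give, by \<open>conv\<close>, a point where both functions are below
  \<open>c\<close>, against \<open>pos\<close>. So the supremum of the lower bounds works.\<close>

lemma minimax_two: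
  fixes f g :: "'k \<Rightarrow> real"
  assumes conv: "\<And>a b s. a \<in> K \<Longrightarrow> b \<in> K \<Longrightarrow> 0 \<le> s \<Longrightarrow> s \<le> 1 \<Longrightarrow>
      \<exists>z\<in>K. f z \<le> s * f a + (1 - s) * f b \<and> g z \<le> s * g a + (1 - s) * g b"
    and pos: "\<And>a. a \<in> K \<Longrightarrow> c \<le> f a \<or> c \<le> g a"
  shows "\<exists>s. 0 \<le> s \<and> s \<le> 1 \<and> (\<forall>a\<in>K. c \<le> s * f a + (1 - s) * g a)"
proof -
  define low where "low b = (c - g b) / (f b - g b)" for b
  define up where "up a = (g a - c) / (g a - f a)" for a
  define B where "B = {b \<in> K. g b < c}"
  define A where "A = {a \<in> K. f a < c}"
  have low01: "0 \<le> low b" "low b \<le> 1" if "b \<in> B" for b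
    using that pos[of b] by (auto simp: B_def low_def divide_simps)
  have up01: "0 \<le> up a" "up a \<le> 1" if "a \<in> A" for a
    using that pos[of a] by (auto simp: A_def up_def divide_simps)
  have cross: "low b \<le> up a" if "a \<in> A" "b \<in> B" for a b
  proof (rule ccontr)
    assume nle: "\<not> low b \<le> up a"
    have a: "a \<in> K" "f a < c" "c \<le> g a" using that pos[of a] by (auto simp: A_def)
    have b: "b \<in> K" "g b < c" "c \<le> f b" using that pos[of b] by (auto simp: B_def)
    have den: "0 < f b - g b" "0 < g a - f a" using a b by auto
    have "(g a - c) * (f b - g b) < (c - g b) * (g a - f a)"
      using nle den by (simp add: low_def up_def not_le divide_simps)
    then have key: "(g a - c) * (f b - c) < (c - g b) * (c - f a)"
      by (simp add: algebra_simps)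
    have "\<exists>s. 0 \<le> s \<and> s \<le> 1 \<and> s * f a + (1 - s) * f b < c \<and> s * g a + (1 - s) * g b < c"
    proof -
      \<comment> \<open>The mixture of the \<open>f\<close> values is below \<open>c\<close> for
        \<open>s > l\<close>, that of the \<open>g\<close> values for \<open>s < r\<close>;
        \<open>key\<close> amounts to \<open>l < r\<close>.\<close>
      define l where "l = (f b - c) / (f b - f a)"
      define r where "r = (c - g b) / (g a - g b)"
      have d: "0 < f b - f a" "0 < g a - g b" using a b by auto
      have "l < r"
      proof -
        have "(f b - c) * (g a - g b) < (c - g b) * (f b - f a)"
          using key by (simp add: algebra_simps)
        then show ?thesis using d by (simp add: l_def r_def divide_simps mult.commute)
      qed
      define s where "s = (l + r) / 2"
      have s: "l < s" "s < r" using \<open>l < r\<close> by (auto simp: s_def)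
      have l0: "0 \<le> l" using d b by (simp add: l_def)
      have r1: "r \<le> 1" using d a by (simp add: r_def divide_simps)
      have "f b - c < s * (f b - f a)" using s(1) d by (simp add: l_def divide_simps)
      moreover have "s * (g a - g b) < c - g b" using s(2) d by (simp add: r_def divide_simps)
      ultimately show ?thesis using s l0 r1
        by (intro exI[of _ s]) (auto simp: algebra_simps)
    qed
    then obtain s where s: "0 \<le> s" "s \<le> 1" "s * f a + (1 - s) * f b < c"
        "s * g a + (1 - s) * g b < c" by auto
    obtain z where "z \<in> K" "f z < c" "g z < c"
      using conv[OF a(1) b(1) s(1,2)] s(3,4) by force
    then show False using pos[of z] by auto
  qed
  \<comment> \<open>The supremum of the empty set is unspecified, hence the separate value
    \<open>0\<close>.\<close>
  define s where "s = (if B = {} then 0 else Sup (low ` B))"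
  have bdd: "bdd_above (low ` B)" using low01 by (auto intro!: bdd_aboveI[of _ 1])
  have s_ge: "low b \<le> s" if "b \<in> B" for b
    using that bdd by (auto simp: s_def intro!: cSup_upper)
  have s_le: "s \<le> up a" if "a \<in> A" for a
    using that cross up01(1) by (auto simp: s_def intro!: cSup_least)
  have s0: "0 \<le> s"
  proof (cases "B = {}")
    case False
    then obtain b where "b \<in> B" by auto
    then show ?thesis using s_ge[of b] low01(1)[of b] by auto
  qed (simp add: s_def)
  have s1: "s \<le> 1"
    using low01(2) by (auto simp: s_def intro!: cSup_least)
  have "c \<le> s * f a + (1 - s) * g a" if K: "a \<in> K" for a
  proof -
    consider "a \<in> A" | "a \<in> B" | "c \<le> f a" "c \<le> g a"
      using K unfolding A_def B_def by fastforce
    then show ?thesis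
    proof cases
      case 1
      then have "c \<le> g a" "f a < c" using pos[OF K] by (auto simp: A_def)
      then show ?thesis using s_le[OF 1] by (simp add: up_def divide_simps algebra_simps)
    next
      case 2
      then have "c \<le> f a" "g a < c" using pos[OF K] by (auto simp: B_def)
      then show ?thesis using s_ge[OF 2] by (simp add: low_def divide_simps algebra_simps)
    next
      case 3
      have "s * c + (1 - s) * c \<le> s * f a + (1 - s) * g a"
        using 3 s0 s1 by (intro add_mono mult_left_mono) auto
      then show ?thesis by (simp add: algebra_simps)
    qed
  qed
  then show ?thesis using s0 s1 by blast
qed

text \<open>Induction on the finite side: on the points \<open>K'\<close> that \<open>x\<close>
  alone does not serve, the induction hypothesis yields a mixture \<open>g\<close> of the other
  functions, and \<open>minimax_two\<close> then mixes \<open>f x\<close> with \<open>g\<close> on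
  all of \<open>K\<close>.\<close>

lemma minimax_finite:
  fixes f :: "'h \<Rightarrow> 'k \<Rightarrow> real"
  assumes "finite H" "H \<noteq> {}"
    and conv: "\<And>a b s. a \<in> K \<Longrightarrow> b \<in> K \<Longrightarrow> 0 \<le> s \<Longrightarrow> s \<le> 1 \<Longrightarrow>
      \<exists>z\<in>K. \<forall>h\<in>H. f h z = s * f h a + (1 - s) * f h b"
    and pos: "\<And>a. a \<in> K \<Longrightarrow> \<exists>h\<in>H. c \<le> f h a"
  shows "\<exists>l. (\<forall>h\<in>H. 0 \<le> l h) \<and> sum l H = 1 \<and> (\<forall>a\<in>K. c \<le> (\<Sum>h\<in>H. l h * f h a))"
  using assms
proof (induction H arbitrary: K rule: finite_ne_induct)
  case (singleton x)
  then show ?case by (intro exI[of _ "\<lambda>_. 1"]) auto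
next
  case (insert x F)
  define K' where "K' = {a \<in> K. f x a < c}"
  have "\<exists>l. (\<forall>h\<in>F. 0 \<le> l h) \<and> sum l F = 1 \<and> (\<forall>a\<in>K'. c \<le> (\<Sum>h\<in>F. l h * f h a))"
  proof (rule insert.IH)
    fix a b s assume ab: "a \<in> K'" "b \<in> K'" "0 \<le> s" "s \<le> (1::real)"
    then obtain z where z: "z \<in> K" "\<forall>h\<in>insert x F. f h z = s * f h a + (1 - s) * f h b"
      using insert.prems(1)[of a b s] by (auto simp: K'_def)
    have "s * f x a + (1 - s) * f x b < c"
      using ab by (intro convex_bound_lt) (auto simp: K'_def)
    then show "\<exists>z\<in>K'. \<forall>h\<in>F. f h z = s * f h a + (1 - s) * f h b"
      using z by (auto simp: K'_def)
  next
    fix a assume "a \<in> K'"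
    then show "\<exists>h\<in>F. c \<le> f h a" using insert.prems(2)[of a] by (auto simp: K'_def)
  qed
  then obtain l where l: "\<forall>h\<in>F. 0 \<le> l h" "sum l F = 1"
      "\<forall>a\<in>K'. c \<le> (\<Sum>h\<in>F. l h * f h a)" by blast
  define g where "g a = (\<Sum>h\<in>F. l h * f h a)" for a
  have "\<exists>s. 0 \<le> s \<and> s \<le> 1 \<and> (\<forall>a\<in>K. c \<le> s * f x a + (1 - s) * g a)"
  proof (rule minimax_two)
    fix a b s assume ab: "a \<in> K" "b \<in> K" "0 \<le> s" "s \<le> (1::real)"
    then obtain z where z: "z \<in> K" "\<forall>h\<in>insert x F. f h z = s * f h a + (1 - s) * f h b"
      using insert.prems(1)[of a b s] by auto
    have "g z = s * g a + (1 - s) * g b"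
      unfolding g_def sum_distrib_left sum.distrib[symmetric]
    proof (intro sum.cong refl)
      fix h assume "h \<in> F"
      then have "f h z = s * f h a + (1 - s) * f h b" using z by auto
      then show "l h * f h z = s * (l h * f h a) + (1 - s) * (l h * f h b)"
        by (simp only:) (simp add: algebra_simps)
    qed
    then show "\<exists>z\<in>K. f x z \<le> s * f x a + (1 - s) * f x b \<and> g z \<le> s * g a + (1 - s) * g b"
      using z by (intro bexI[of _ z]) auto
  next
    fix a assume "a \<in> K"
    then show "c \<le> f x a \<or> c \<le> g a" using l(3) by (auto simp: K'_def g_def not_less)
  qed
  then obtain s where s: "0 \<le> s" "s \<le> 1" "\<forall>a\<in>K. c \<le> s * f x a + (1 - s) * g a" by blast
  define l' where "l' h = (if h = x then s else (1 - s) * l h)" for h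
  have eq: "(\<Sum>h\<in>F. l' h * u h) = (1 - s) * (\<Sum>h\<in>F. l h * u h)" for u :: "'h \<Rightarrow> real"
    unfolding sum_distrib_left using insert.hyps by (intro sum.cong) (auto simp: l'_def)
  show ?case
  proof (intro exI[of _ l'] conjI ballI)
    show "0 \<le> l' h" if "h \<in> insert x F" for h using that s l(1) by (auto simp: l'_def)
    show "sum l' (insert x F) = 1"
      using eq[of "\<lambda>_. 1"] insert.hyps l(2) by (simp add: l'_def)
    show "c \<le> (\<Sum>h\<in>insert x F. l' h * f h a)" if "a \<in> K" for a
      using s(3) that insert.hyps eq[of "\<lambda>h. f h a"] by (simp add: l'_def g_def)
  qed
qed

section \<open>Existence of protocols\<close>

text \<open>\<open>D\<close> is a promise on the inputs: a later phase has to be correct only for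
  the profiles consistent with the blackboard. Speaking of mere existence lets protocols be
  assembled by induction.\<close>

definition solvable ::
    "nat set \<Rightarrow> nat \<Rightarrow> (nat \<Rightarrow> 'x) set \<Rightarrow> ((nat \<Rightarrow> 'x) \<Rightarrow> 'o \<Rightarrow> bool) \<Rightarrow> bool" where
  "solvable I d D R \<longleftrightarrow> (\<exists>P :: ('x, 'o) protocol. speakers P \<subseteq> I \<and>
     (\<forall>v\<in>D. length (transcript P v) \<le> d \<and> R v (outcome P v)))"

lemma solvable_output: "(\<And>v. v \<in> D \<Longrightarrow> R v a) \<Longrightarrow> solvable I d D R"
  unfolding solvable_def by (intro exI[of _ "Output a"]) auto

lemma solvable_empty [simp]: "solvable I d {} R"
  by (rule solvable_output) auto

lemma solvable_mono:
  assumes "solvable I d' D' R'" "d' \<le> d" "D \<subseteq> D'" "\<And>v a. v \<in> D \<Longrightarrow> R' v a \<Longrightarrow> R v a"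
  shows "solvable I d D R"
  using assms unfolding solvable_def by (meson le_trans subsetD)

lemma solvable_bit:
  assumes "i \<in> I" "solvable I d {v \<in> D. f (v i)} R" "solvable I d {v \<in> D. \<not> f (v i)} R"
  shows "solvable I (Suc d) D R"
proof -
  obtain P1 where P1: "speakers P1 \<subseteq> I"
      "\<forall>v\<in>{v \<in> D. f (v i)}. length (transcript P1 v) \<le> d \<and> R v (outcome P1 v)"
    using assms(2) unfolding solvable_def by auto
  obtain P0 where P0: "speakers P0 \<subseteq> I"
      "\<forall>v\<in>{v \<in> D. \<not> f (v i)}. length (transcript P0 v) \<le> d \<and> R v (outcome P0 v)"
    using assms(3) unfolding solvable_def by auto
  show ?thesis unfolding solvable_def
    by (rule exI[of _ "Speak i f P0 P1"]) (use P0 P1 assms(1) in auto)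
qed

primrec bind_protocol ::
    "('x, 'a) protocol \<Rightarrow> ('a \<Rightarrow> ('x, 'o) protocol) \<Rightarrow> ('x, 'o) protocol" where
  "bind_protocol (Output a) F = F a"
| "bind_protocol (Speak i f P0 P1) F = Speak i f (bind_protocol P0 F) (bind_protocol P1 F)"

lemma outcome_bind [simp]: "outcome (bind_protocol P F) v = outcome (F (outcome P v)) v"
  by (induction P) auto

lemma transcript_bind [simp]:
  "transcript (bind_protocol P F) v = transcript P v @ transcript (F (outcome P v)) v"
  by (induction P) auto

lemma speakers_bind:
  "speakers P \<subseteq> I \<Longrightarrow> (\<And>a. speakers (F a) \<subseteq> I) \<Longrightarrow> speakers (bind_protocol P F) \<subseteq> I"
  by (induction P) auto

text \<open>The output \<open>a\<close> of the first phase can be read off the blackboard, so the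
  second protocol may be chosen separately for each \<open>a\<close> and works under the promise
  \<open>R1 v a\<close>.\<close>

lemma solvable_bind:
  assumes "solvable I d1 D R1" "\<And>a. solvable I d2 {v \<in> D. R1 v a} R"
  shows "solvable I (d1 + d2) D R"
proof -
  obtain P where P: "speakers P \<subseteq> I"
      "\<forall>v\<in>D. length (transcript P v) \<le> d1 \<and> R1 v (outcome P v)"
    using assms(1) unfolding solvable_def by auto
  have "\<forall>a. \<exists>Q. speakers Q \<subseteq> I \<and>
     (\<forall>v\<in>{v \<in> D. R1 v a}. length (transcript Q v) \<le> d2 \<and> R v (outcome Q v))"
    using assms(2) unfolding solvable_def by blast
  then obtain F where F: "\<And>a. speakers (F a) \<subseteq> I"
     "\<And>a v. v \<in> D \<Longrightarrow> R1 v a \<Longrightarrow> length (transcript (F a) v) \<le> d2 \<and> R v (outcome (F a) v)"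
    by (metis (mono_tags, lifting) mem_Collect_eq)
  show ?thesis unfolding solvable_def
  proof (intro exI[of _ "bind_protocol P F"] conjI ballI)
    show "speakers (bind_protocol P F) \<subseteq> I" using P(1) F(1) by (rule speakers_bind)
  qed (use P F in \<open>auto intro!: add_mono\<close>)
qed

lemma solvable_family:
  assumes "finite F" "\<And>X. X \<in> F \<Longrightarrow> solvable I d D (R X)"
  shows "solvable I (card F * d) D (\<lambda>v a. \<forall>X\<in>F. R X v (a X))"
  using assms
proof (induction F rule: finite_induct)
  case empty
  then show ?case by (auto intro: solvable_output)
next
  case (insert X F)
  have "solvable I (d + card F * d) D (\<lambda>v a. \<forall>Y\<in>insert X F. R Y v (a Y))"
  proof (rule solvable_bind)
    show "solvable I d D (R X)" using insert.prems by auto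
    fix b
    have "solvable I (card F * d + 0) {v \<in> D. R X v b} (\<lambda>v a. \<forall>Y\<in>insert X F. R Y v (a Y))"
    proof (rule solvable_bind)
      show "solvable I (card F * d) {v \<in> D. R X v b} (\<lambda>v a. \<forall>Y\<in>F. R Y v (a Y))"
        by (rule solvable_mono[OF insert.IH]) (use insert.prems in auto)
      show "solvable I 0 {v \<in> {v \<in> D. R X v b}. \<forall>Y\<in>F. R Y v (a Y)}
          (\<lambda>v a. \<forall>Y\<in>insert X F. R Y v (a Y))" for a
        using insert.hyps by (intro solvable_output[of _ _ "a(X := b)"]) auto
    qed
    then show "solvable I (card F * d) {v \<in> D. R X v b} (\<lambda>v a. \<forall>Y\<in>insert X F. R Y v (a Y))"
      by simp
  qed
  then show ?case using insert.hyps by simp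
qed

lemma finite_halves:
  assumes "finite B" "card B \<le> 2 ^ Suc c"
  obtains B1 B2 where "B = B1 \<union> B2" "B1 \<inter> B2 = {}" "card B1 \<le> 2 ^ c" "card B2 \<le> 2 ^ c"
proof -
  obtain B1 where B1: "B1 \<subseteq> B" "card B1 = card B div 2"
    using obtain_subset_with_card_n[of "card B div 2" B] by auto
  show thesis
    by (rule that[of B1 "B - B1"])
      (use B1 assms in \<open>auto simp: card_Diff_subset finite_subset\<close>)
qed

text \<open>Each bit halves the set of candidates for \<open>g (v i)\<close>, so \<open>c\<close>
  bits identify the value, and the continuation may depend on it.\<close>

lemma solvable_announce:
  assumes "i \<in> I" "finite B" "card B \<le> 2 ^ c" "\<And>v. v \<in> D \<Longrightarrow> g (v i) \<in> B"
    "\<And>b. b \<in> B \<Longrightarrow> solvable I d {v \<in> D. g (v i) = b} R"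
  shows "solvable I (c + d) D R"
  using assms(2-5)
proof (induction c arbitrary: B D)
  case 0
  show ?case
  proof (cases "B = {}")
    case True
    then have "D = {}" using 0 by auto
    then show ?thesis by simp
  next
    case False
    then have "card B \<noteq> 0" using 0(1) by simp
    then have "card B = 1" using 0(2) by auto
    then obtain b where "B = {b}" by (auto simp: card_1_singleton_iff)
    then show ?thesis using 0 by (intro solvable_mono[OF 0(4)[of b]]) auto
  qed
next
  case (Suc c)
  obtain B1 B2 where B: "B = B1 \<union> B2" "B1 \<inter> B2 = {}" "card B1 \<le> 2 ^ c" "card B2 \<le> 2 ^ c"
    using finite_halves[OF Suc.prems(1,2)] by blast
  have fin: "finite B1" "finite B2" using Suc.prems(1) B by auto
  have "solvable I (Suc (c + d)) D R"
  proof (rule solvable_bit[OF assms(1), where f = "\<lambda>x. g x \<in> B1"])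
    show "solvable I (c + d) {v \<in> D. g (v i) \<in> B1} R"
      by (rule Suc.IH[OF fin(1) B(3)])
        (use Suc.prems(4) B in \<open>auto intro: solvable_mono[where d' = d]\<close>)
    show "solvable I (c + d) {v \<in> D. g (v i) \<notin> B1} R"
      by (rule Suc.IH[OF fin(2) B(4)])
        (use Suc.prems(3,4) B in \<open>auto intro: solvable_mono[where d' = d]\<close>)
  qed
  then show ?case by simp
qed

lemma solvable_announce_all:
  assumes "finite J" "J \<subseteq> I" "finite B" "card B \<le> 2 ^ c"
    "\<And>v i. v \<in> D \<Longrightarrow> i \<in> J \<Longrightarrow> g i (v i) \<in> B"
    "\<And>h. solvable I d {v \<in> D. \<forall>i\<in>J. g i (v i) = h i} R"
  shows "solvable I (card J * c + d) D R"
  using assms(1,2,5,6)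
proof (induction J arbitrary: D rule: finite_induct)
  case empty
  show ?case using empty(3)[of undefined] by simp
next
  case (insert j J)
  have "solvable I (c + (card J * c + d)) D R"
  proof (rule solvable_announce[where g = "g j" and i = j and B = B])
    fix b
    show "solvable I (card J * c + d) {v \<in> D. g j (v j) = b} R"
    proof (rule insert.IH)
      fix h
      show "solvable I d {v \<in> {v \<in> D. g j (v j) = b}. \<forall>i\<in>J. g i (v i) = h i} R"
        by (rule solvable_mono[OF insert.prems(3)[of "h(j := b)"]])
          (use insert.hyps in auto)
    qed (use insert.prems in auto)
  qed (use insert.prems assms in auto)
  then show ?case using insert.hyps by (simp add: add.assoc)
qed

section \<open>Supporting prices for subadditive valuations\<close>

lemma sum_PiE_insert:
  fixes g :: "('i \<Rightarrow> 'x) \<Rightarrow> real"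
  assumes "i \<notin> N"
  shows "(\<Sum>b\<in>insert i N \<rightarrow>\<^sub>E X. g b) = (\<Sum>x\<in>X. \<Sum>b\<in>N \<rightarrow>\<^sub>E X. g (b(i := x)))"
proof -
  have "(\<Sum>b\<in>insert i N \<rightarrow>\<^sub>E X. g b) = (\<Sum>(x, b)\<in>X \<times> (N \<rightarrow>\<^sub>E X). g (b(i := x)))"
    unfolding PiE_insert_eq
    by (subst sum.reindex[OF inj_combinator[OF assms]]) (simp add: case_prod_unfold)
  then show ?thesis by (simp add: sum.cartesian_product)
qed

lemma sum_PiE_prod_eq_1:
  fixes y :: "'i \<Rightarrow> 'x \<Rightarrow> real"
  assumes "finite N" "\<And>i. i \<in> N \<Longrightarrow> sum (y i) X = 1"
  shows "(\<Sum>b\<in>N \<rightarrow>\<^sub>E X. \<Prod>i\<in>N. y i (b i)) = 1"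
  using assms
proof (induction N rule: finite_induct)
  case (insert i N)
  have "(\<Prod>k\<in>insert i N. y k ((b(i := x)) k)) = y i x * (\<Prod>k\<in>N. y k (b k))" for b x
  proof -
    have "(\<Prod>k\<in>N. y k ((b(i := x)) k)) = (\<Prod>k\<in>N. y k (b k))"
      using insert.hyps by (intro prod.cong) auto
    then show ?thesis using insert.hyps by simp
  qed
  then have "(\<Sum>b\<in>insert i N \<rightarrow>\<^sub>E X. \<Prod>k\<in>insert i N. y k (b k)) =
      (\<Sum>x\<in>X. y i x) * (\<Sum>b\<in>N \<rightarrow>\<^sub>E X. \<Prod>k\<in>N. y k (b k))"
    unfolding sum_PiE_insert[OF insert.hyps(2)] by (simp only: sum_product)
  then show ?case using insert by simp
qed simp

text \<open>Under the product distribution with marginals \<open>y i\<close>, the coordinate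
  \<open>b i\<close> is independent of \<open>G x b\<close>, which ignores that coordinate. So a
  fresh draw from \<open>y i\<close> may be replaced by \<open>b i\<close> itself.\<close>

lemma sum_PiE_resample:
  fixes y :: "'i \<Rightarrow> 'x \<Rightarrow> real"
  assumes "finite N" "i \<in> N" "sum (y i) X = 1"
    and G: "\<And>x b z. G x (b(i := z)) = G x b"
  shows "(\<Sum>b\<in>N \<rightarrow>\<^sub>E X. (\<Prod>k\<in>N. y k (b k)) * (\<Sum>x\<in>X. y i x * G x b)) =
         (\<Sum>b\<in>N \<rightarrow>\<^sub>E X. (\<Prod>k\<in>N. y k (b k)) * G (b i) b)"
proof -
  define M where "M = N - {i}"
  have N: "N = insert i M" "i \<notin> M" "finite M" using assms by (auto simp: M_def)
  define w where "w b = (\<Prod>k\<in>M. y k (b k))" for b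
  define S where "S b = (\<Sum>x\<in>X. y i x * G x b)" for b
  have w: "(\<Prod>k\<in>N. y k ((b(i := x)) k)) = y i x * w b" for b x
  proof -
    have "(\<Prod>k\<in>M. y k ((b(i := x)) k)) = w b"
      unfolding w_def using N by (intro prod.cong) auto
    then show ?thesis using N by simp
  qed
  have "(\<Sum>b\<in>N \<rightarrow>\<^sub>E X. (\<Prod>k\<in>N. y k (b k)) * S b) = (\<Sum>z\<in>X. \<Sum>b\<in>M \<rightarrow>\<^sub>E X. y i z * w b * S b)"
    using sum_PiE_insert[OF N(2), of "\<lambda>b. (\<Prod>k\<in>N. y k (b k)) * S b" X]
    unfolding w S_def G N(1)[symmetric] .
  also have "\<dots> = (\<Sum>z\<in>X. y i z) * (\<Sum>b\<in>M \<rightarrow>\<^sub>E X. w b * S b)"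
    by (simp only: sum_product mult.assoc)
  also have "\<dots> = (\<Sum>b\<in>M \<rightarrow>\<^sub>E X. \<Sum>x\<in>X. w b * (y i x * G x b))"
    by (simp only: assms(3) mult_1 S_def sum_distrib_left)
  also have "\<dots> = (\<Sum>x\<in>X. \<Sum>b\<in>M \<rightarrow>\<^sub>E X. w b * (y i x * G x b))"
    by (rule sum.swap)
  also have "\<dots> = (\<Sum>x\<in>X. \<Sum>b\<in>M \<rightarrow>\<^sub>E X. y i x * w b * G x b)"
    by (simp only: mult_ac)
  also have "\<dots> = (\<Sum>b\<in>N \<rightarrow>\<^sub>E X. (\<Prod>k\<in>N. y k (b k)) * G (b i) b)"
    using sum_PiE_insert[OF N(2), of "\<lambda>b. (\<Prod>k\<in>N. y k (b k)) * G (b i) b" X]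
    unfolding w G N(1)[symmetric] by simp
  finally show ?thesis unfolding S_def .
qed

lemma weighted_sum_add_sum:
  fixes w :: "'b \<Rightarrow> real"
  shows "(\<Sum>b\<in>B. w b * (a b + (\<Sum>i\<in>N. g i b))) =
    (\<Sum>b\<in>B. w b * a b) + (\<Sum>i\<in>N. \<Sum>b\<in>B. w b * g i b)"
proof -
  have "(\<Sum>i\<in>N. \<Sum>b\<in>B. w b * g i b) = (\<Sum>b\<in>B. \<Sum>i\<in>N. w b * g i b)" by (rule sum.swap)
  then show ?thesis by (simp add: distrib_left sum.distrib sum_distrib_left)
qed

section \<open>Allocations, and deviations in the all-pay auction\<close>

text \<open>Bidders and items are parameters because the subadditive bidders will compete for
  whatever items the single-minded winners leave.\<close>

definition alloc :: "nat set \<Rightarrow> 'a set \<Rightarrow> (nat \<Rightarrow> 'a set) set" where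
  "alloc N R = {A \<in> N \<rightarrow>\<^sub>E Pow R. disjoint_family_on A N}"

lemma finite_alloc: "finite N \<Longrightarrow> finite R \<Longrightarrow> finite (alloc N R)"
  unfolding alloc_def by (rule finite_subset[OF Collect_restrict]) (simp add: finite_PiE)

lemma alloc_nonempty: "alloc N R \<noteq> {}"
proof -
  have "(\<lambda>i\<in>N. {}) \<in> alloc N R" by (auto simp: alloc_def disjoint_family_on_def)
  then show ?thesis by blast
qed

definition subadditive_valuation :: "'a set \<Rightarrow> ('a set \<Rightarrow> real) \<Rightarrow> bool" where
  "subadditive_valuation R v \<longleftrightarrow> v {} = 0 \<and> (\<forall>S T. S \<subseteq> T \<and> T \<subseteq> R \<longrightarrow> v S \<le> v T) \<and>
     (\<forall>S T. S \<subseteq> R \<and> T \<subseteq> R \<longrightarrow> v (S \<union> T) \<le> v S + v T)"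

lemma subadditive_valuation_nonneg:
  "subadditive_valuation R v \<Longrightarrow> S \<subseteq> R \<Longrightarrow> 0 \<le> v S"
  unfolding subadditive_valuation_def by (metis (no_types) empty_subsetI)

text \<open>The utility in an all-pay auction: the bid \<open>b\<close> wins an item by strictly
  exceeding its price and is paid on every item, won or not. Bids are integers in units of
  \<open>\<delta>\<close>, which makes the spaces of bids and prices finite.\<close>

definition deviation ::
    "'a set \<Rightarrow> real \<Rightarrow> ('a set \<Rightarrow> real) \<Rightarrow> ('a \<Rightarrow> nat) \<Rightarrow> ('a \<Rightarrow> nat) \<Rightarrow> real" where
  "deviation R \<delta> v b p = v {j \<in> R. p j < b j} - \<delta> * (\<Sum>j\<in>R. real (b j))"

lemma deviation_antimono:
  assumes "subadditive_valuation R v" "\<And>j. j \<in> R \<Longrightarrow> q j \<le> p j"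
  shows "deviation R \<delta> v b p \<le> deviation R \<delta> v b q"
proof -
  have "v {j \<in> R. p j < b j} \<le> v {j \<in> R. q j < b j}"
  proof -
    have "{j \<in> R. p j < b j} \<subseteq> {j \<in> R. q j < b j}" using assms(2) by (auto intro: le_less_trans)
    moreover have "\<forall>S T. S \<subseteq> T \<and> T \<subseteq> R \<longrightarrow> v S \<le> v T"
      using assms(1) by (simp add: subadditive_valuation_def)
    ultimately show ?thesis by simp
  qed
  then show ?thesis by (simp add: deviation_def)
qed

text \<open>The price vector is the sum of the bids, drawn independently from \<open>y\<close>, of an all-pay auction:
  there a deviation by \<open>i\<close> to a fresh draw from \<open>y i\<close> changes nothing. A bid above the cap \<open>c\<close>
  exceeds every value and is replaced by zero bids.\<close>

lemma exists_price_vector: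
  fixes v :: "nat \<Rightarrow> 'a set \<Rightarrow> real"
  assumes "finite N" "finite R" and v: "\<And>i. i \<in> N \<Longrightarrow> subadditive_valuation R (v i)"
    and W: "\<And>A. A \<in> alloc N R \<Longrightarrow> (\<Sum>i\<in>N. v i (A i)) \<le> W"
    and "\<delta> > 0" and cap: "\<And>i. i \<in> N \<Longrightarrow> v i R \<le> \<delta> * real (Suc c)"
    and C: "C = R \<rightarrow>\<^sub>E {..card N * c}" and B: "B = R \<rightarrow>\<^sub>E {..Suc (card N * c)}"
    and y: "\<And>i b. i \<in> N \<Longrightarrow> b \<in> B \<Longrightarrow> 0 \<le> y i b" "\<And>i. i \<in> N \<Longrightarrow> sum (y i) B = 1"
  shows "\<exists>p\<in>C. \<delta> * (\<Sum>j\<in>R. real (p j)) + (\<Sum>i\<in>N. \<Sum>b\<in>B. y i b * deviation R \<delta> (v i) b p) \<le> W"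
proof (rule ccontr)
  assume "\<not> ?thesis"
  \<comment> \<open>If every price vector is too expensive, so is the random one formed by the sum
    of bids drawn independently from the \<open>y i\<close>; averaging over it ends in
    \<open>W < W\<close>.\<close>
  then have contra: "W < \<delta> * (\<Sum>j\<in>R. real (p j)) + (\<Sum>i\<in>N. \<Sum>b\<in>B. y i b * deviation R \<delta> (v i) b p)"
    if "p \<in> C" for p using that by force
  define r where "r b = (if \<forall>j\<in>R. b j \<le> c then b else (\<lambda>_. 0))" for b :: "'a \<Rightarrow> nat"
  have r_le: "r b j \<le> c" if "j \<in> R" for b j using that by (auto simp: r_def)
  have dev_r: "deviation R \<delta> (v i) b p \<le> deviation R \<delta> (v i) (r b) p" if i: "i \<in> N" for i b p
  proof (cases "\<forall>j\<in>R. b j \<le> c")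
    case False
    then obtain j where j: "j \<in> R" "Suc c \<le> b j" by (auto simp: not_le)
    have "v i {j \<in> R. p j < b j} \<le> v i R" using v[OF i] by (auto simp: subadditive_valuation_def)
    also have "\<dots> \<le> \<delta> * real (Suc c)" by (rule cap[OF i])
    also have "\<dots> \<le> \<delta> * real (b j)" using j \<open>\<delta> > 0\<close> by (intro mult_left_mono) auto
    also have "\<dots> \<le> \<delta> * (\<Sum>j\<in>R. real (b j))"
      using j \<open>\<delta> > 0\<close> \<open>finite R\<close> by (intro mult_left_mono member_le_sum) auto
    finally have "deviation R \<delta> (v i) b p \<le> 0" by (simp add: deviation_def)
    also have "0 \<le> deviation R \<delta> (v i) (r b) p"
      using False v[OF i] by (auto simp: deviation_def r_def subadditive_valuation_def)
    finally show ?thesis .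
  qed (simp add: r_def)
  define P where "P M b j = (\<Sum>k\<in>M. r (b k) j)" for M :: "nat set" and b j
  define w where "w b = (\<Prod>k\<in>N. y k (b k))" for b
  have w_nonneg: "0 \<le> w b" if "b \<in> N \<rightarrow>\<^sub>E B" for b
    using that y by (auto simp: w_def intro!: prod_nonneg)
  have w_sum: "(\<Sum>b\<in>N \<rightarrow>\<^sub>E B. w b) = 1"
    unfolding w_def by (rule sum_PiE_prod_eq_1[OF \<open>finite N\<close> y(2)])
  have price: "restrict (P N b) R \<in> C" for b
  proof -
    have "P N b j \<le> card N * c" if "j \<in> R" for j
      using sum_bounded_above[of N "\<lambda>k. r (b k) j" c] r_le that by (simp add: P_def)
    then show ?thesis by (auto simp: C)
  qed
  have dev_restrict: "deviation R \<delta> u b (restrict p R) = deviation R \<delta> u b p" for u b p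
    unfolding deviation_def by (intro arg_cong2[where f = minus] arg_cong[where f = u]) auto
  have split: "P N b j = r (b i) j + P (N - {i}) b j" if "i \<in> N" for b i j
    using that \<open>finite N\<close> unfolding P_def by (simp add: sum.remove)
  text \<open>A bid exceeding the sum of all the others wins the item, and at most one bid does.\<close>
  have welf: "\<delta> * (\<Sum>j\<in>R. real (P N b j)) +
      (\<Sum>i\<in>N. deviation R \<delta> (v i) (r (b i)) (P (N - {i}) b)) \<le> W" for b
  proof -
    define A where "A = (\<lambda>i\<in>N. {j \<in> R. P (N - {i}) b j < r (b i) j})"
    have "disjoint_family_on A N"
    proof (unfold disjoint_family_on_def, intro ballI impI)
      fix i k assume ik: "i \<in> N" "k \<in> N" "i \<noteq> k"
      have "r (b k) j \<le> P (N - {i}) b j" "r (b i) j \<le> P (N - {k}) b j" for j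
        unfolding P_def using ik \<open>finite N\<close> by (auto intro!: member_le_sum)
      then show "A i \<inter> A k = {}" using ik
        by (auto simp: A_def) (meson le_less_trans less_asym)
    qed
    moreover have "A \<in> N \<rightarrow>\<^sub>E Pow R" by (auto simp: A_def)
    ultimately have "(\<Sum>i\<in>N. v i (A i)) \<le> W" by (intro W) (simp add: alloc_def)
    \<comment> \<open>All bids are paid, so the revenue cancels against the payments inside
      \<open>deviation\<close>, and only the welfare of \<open>A\<close> remains.\<close>
    moreover have "(\<Sum>j\<in>R. real (P N b j)) = (\<Sum>i\<in>N. \<Sum>j\<in>R. real (r (b i) j))"
      unfolding P_def by (subst sum.swap) simp
    ultimately show ?thesis
      by (simp add: deviation_def A_def sum_subtractf sum_distrib_left)
  qed
  have finB: "finite (N \<rightarrow>\<^sub>E B)" using assms by (auto simp: B intro!: finite_PiE)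
  have "W = (\<Sum>b\<in>N \<rightarrow>\<^sub>E B. w b * W)" using w_sum by (simp add: sum_distrib_right[symmetric])
  also have "\<dots> < (\<Sum>b\<in>N \<rightarrow>\<^sub>E B. w b * (\<delta> * (\<Sum>j\<in>R. real (P N b j)) +
      (\<Sum>i\<in>N. \<Sum>x\<in>B. y i x * deviation R \<delta> (v i) x (P N b))))"
  proof (rule sum_strict_mono_ex1[OF finB])
    have le: "W < \<delta> * (\<Sum>j\<in>R. real (P N b j)) +
      (\<Sum>i\<in>N. \<Sum>x\<in>B. y i x * deviation R \<delta> (v i) x (P N b))" for b
      using contra[OF price[of b]] by (simp add: dev_restrict)
    then show "\<forall>b\<in>N \<rightarrow>\<^sub>E B. w b * W \<le> w b * (\<delta> * (\<Sum>j\<in>R. real (P N b j)) +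
      (\<Sum>i\<in>N. \<Sum>x\<in>B. y i x * deviation R \<delta> (v i) x (P N b)))"
      using w_nonneg by (intro ballI mult_left_mono) (auto intro: less_imp_le)
    obtain b where "b \<in> N \<rightarrow>\<^sub>E B" "w b \<noteq> 0" using w_sum by (metis sum.neutral zero_neq_one)
    then show "\<exists>b\<in>N \<rightarrow>\<^sub>E B. w b * W < w b * (\<delta> * (\<Sum>j\<in>R. real (P N b j)) +
      (\<Sum>i\<in>N. \<Sum>x\<in>B. y i x * deviation R \<delta> (v i) x (P N b)))"
      using w_nonneg[of b] le[of b] by (intro bexI[of _ b] mult_strict_left_mono) auto
  qed
  \<comment> \<open>Capping a deviating bid does not hurt the bidder, and removing her own bid only
    lowers the prices she faces. The remaining prices ignore coordinate \<open>i\<close>, as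
    resampling demands.\<close>
  also have "\<dots> \<le> (\<Sum>b\<in>N \<rightarrow>\<^sub>E B. w b * (\<delta> * (\<Sum>j\<in>R. real (P N b j)) +
      (\<Sum>i\<in>N. \<Sum>x\<in>B. y i x * deviation R \<delta> (v i) (r x) (P (N - {i}) b))))"
  proof (intro sum_mono mult_left_mono add_left_mono)
    fix b i x assume "i \<in> N" "x \<in> B"
    have "deviation R \<delta> (v i) x (P N b) \<le> deviation R \<delta> (v i) (r x) (P N b)"
      by (rule dev_r[OF \<open>i \<in> N\<close>])
    also have "\<dots> \<le> deviation R \<delta> (v i) (r x) (P (N - {i}) b)"
      by (rule deviation_antimono[OF v[OF \<open>i \<in> N\<close>]]) (simp add: split[OF \<open>i \<in> N\<close>])
    finally show "deviation R \<delta> (v i) x (P N b) \<le> deviation R \<delta> (v i) (r x) (P (N - {i}) b)" .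
  qed (use w_nonneg y in auto)
  also have "\<dots> = (\<Sum>b\<in>N \<rightarrow>\<^sub>E B. w b * (\<delta> * (\<Sum>j\<in>R. real (P N b j)))) +
      (\<Sum>i\<in>N. \<Sum>b\<in>N \<rightarrow>\<^sub>E B. w b * (\<Sum>x\<in>B. y i x * deviation R \<delta> (v i) (r x) (P (N - {i}) b)))"
    by (simp only: weighted_sum_add_sum)
  also have "(\<Sum>i\<in>N. \<Sum>b\<in>N \<rightarrow>\<^sub>E B. w b * (\<Sum>x\<in>B. y i x * deviation R \<delta> (v i) (r x) (P (N - {i}) b))) =
      (\<Sum>i\<in>N. \<Sum>b\<in>N \<rightarrow>\<^sub>E B. w b * deviation R \<delta> (v i) (r (b i)) (P (N - {i}) b))"
  proof (rule sum.cong[OF refl])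
    fix i assume "i \<in> N"
    have "P (N - {i}) (\<lambda>a. if a = i then z else b a) = P (N - {i}) b" for b z by (auto simp: P_def intro!: ext sum.cong)
    then show "(\<Sum>b\<in>N \<rightarrow>\<^sub>E B. w b * (\<Sum>x\<in>B. y i x * deviation R \<delta> (v i) (r x) (P (N - {i}) b))) =
      (\<Sum>b\<in>N \<rightarrow>\<^sub>E B. w b * deviation R \<delta> (v i) (r (b i)) (P (N - {i}) b))"
      unfolding w_def using \<open>i \<in> N\<close> \<open>finite N\<close> y(2) by (intro sum_PiE_resample) (simp_all add: fun_upd_def)
  qed
  also have "(\<Sum>b\<in>N \<rightarrow>\<^sub>E B. w b * (\<delta> * (\<Sum>j\<in>R. real (P N b j)))) +
      (\<Sum>i\<in>N. \<Sum>b\<in>N \<rightarrow>\<^sub>E B. w b * deviation R \<delta> (v i) (r (b i)) (P (N - {i}) b)) =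
      (\<Sum>b\<in>N \<rightarrow>\<^sub>E B. w b * (\<delta> * (\<Sum>j\<in>R. real (P N b j)) +
      (\<Sum>i\<in>N. deviation R \<delta> (v i) (r (b i)) (P (N - {i}) b))))"
    by (simp only: weighted_sum_add_sum)
  also have "\<dots> \<le> (\<Sum>b\<in>N \<rightarrow>\<^sub>E B. w b * W)"
    using welf w_nonneg by (intro sum_mono mult_left_mono)
  also have "\<dots> = W" using w_sum by (simp add: sum_distrib_right[symmetric])
  finally show False by simp
qed

text \<open>Minimax in the game between a price setter and mixed deviations:
  \<open>exists_price_vector\<close> answers each \<open>y\<close> that is known in advance, hence
  one distribution \<open>l\<close> over prices answers all deviations at once.\<close>

lemma exists_price_distribution:
  fixes v :: "nat \<Rightarrow> 'a set \<Rightarrow> real"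
  assumes "finite N" "finite R" and v: "\<And>i. i \<in> N \<Longrightarrow> subadditive_valuation R (v i)"
    and W: "\<And>A. A \<in> alloc N R \<Longrightarrow> (\<Sum>i\<in>N. v i (A i)) \<le> W"
    and "\<delta> > 0" and cap: "\<And>i. i \<in> N \<Longrightarrow> v i R \<le> \<delta> * real (Suc c)"
    and C: "C = R \<rightarrow>\<^sub>E {..card N * c}" and B: "B = R \<rightarrow>\<^sub>E {..Suc (card N * c)}"
  shows "\<exists>l. (\<forall>p\<in>C. 0 \<le> l p) \<and> sum l C = 1 \<and> (\<forall>b\<in>N \<rightarrow> B.
    (\<Sum>p\<in>C. l p * (\<delta> * (\<Sum>j\<in>R. real (p j)) + (\<Sum>i\<in>N. deviation R \<delta> (v i) (b i) p))) \<le> W)"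
proof -
  define K where "K = {y. \<forall>i\<in>N. (\<forall>b\<in>B. 0 \<le> y i b) \<and> sum (y i) B = (1::real)}"
  \<comment> \<open>Negated, because \<open>minimax_finite\<close> bounds from below.\<close>
  define f where "f p y = - (\<delta> * (\<Sum>j\<in>R. real (p j)) +
      (\<Sum>i\<in>N. \<Sum>b\<in>B. y i b * deviation R \<delta> (v i) b p))" for p y
  have fin: "finite C" "finite B" using \<open>finite R\<close> by (simp_all add: B C finite_PiE)
  have "(\<lambda>j\<in>R. 0) \<in> C" by (auto simp: C)
  then have ne: "C \<noteq> {}" by blast
  have "\<exists>l. (\<forall>p\<in>C. 0 \<le> l p) \<and> sum l C = 1 \<and> (\<forall>y\<in>K. - W \<le> (\<Sum>p\<in>C. l p * f p y))"
  proof (rule minimax_finite[OF fin(1) ne])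
    fix y z s assume yz: "y \<in> K" "z \<in> K" "0 \<le> s" "s \<le> (1::real)"
    define x where "x i b = s * y i b + (1 - s) * z i b" for i b
    have "x \<in> K"
      using yz by (simp add: K_def x_def sum.distrib sum_distrib_left[symmetric])
    moreover have "f p x = s * f p y + (1 - s) * f p z" for p
    proof -
      have "(\<Sum>i\<in>N. \<Sum>b\<in>B. x i b * deviation R \<delta> (v i) b p) =
          s * (\<Sum>i\<in>N. \<Sum>b\<in>B. y i b * deviation R \<delta> (v i) b p) +
          (1 - s) * (\<Sum>i\<in>N. \<Sum>b\<in>B. z i b * deviation R \<delta> (v i) b p)"
        unfolding x_def distrib_right sum.distrib sum_distrib_left by (simp only: mult.assoc)
      then show ?thesis unfolding f_def by (simp only:) (simp add: algebra_simps)
    qed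
    ultimately show "\<exists>x\<in>K. \<forall>p\<in>C. f p x = s * f p y + (1 - s) * f p z" by blast
  next
    fix y assume "y \<in> K"
    then have "\<exists>p\<in>C. \<delta> * (\<Sum>j\<in>R. real (p j)) +
        (\<Sum>i\<in>N. \<Sum>b\<in>B. y i b * deviation R \<delta> (v i) b p) \<le> W"
      using assms by (intro exists_price_vector) (auto simp: K_def)
    then show "\<exists>p\<in>C. - W \<le> f p y"
      unfolding f_def by (simp only: neg_le_iff_le)
  qed
  then obtain l where l: "\<forall>p\<in>C. 0 \<le> l p" "sum l C = 1"
    "\<And>y. y \<in> K \<Longrightarrow> - W \<le> (\<Sum>p\<in>C. l p * f p y)" by blast
  show ?thesis
  proof (intro exI[of _ l] conjI ballI)
    fix b assume b: "b \<in> N \<rightarrow> B"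
    define y where "y i x = (if x = b i then 1 else 0 :: real)" for i x
    have y_sum: "(\<Sum>x\<in>B. y i x * g x) = g (b i)" if "i \<in> N" for i and g :: "('a \<Rightarrow> nat) \<Rightarrow> real"
    proof -
      have "(\<Sum>x\<in>B. y i x * g x) = (\<Sum>x\<in>B. if x = b i then g x else 0)"
        by (intro sum.cong) (auto simp: y_def)
      then show ?thesis using b that fin by (auto simp: Pi_def)
    qed
    have "y \<in> K" using y_sum[of _ "\<lambda>_. 1"] by (simp add: K_def) (simp add: y_def)
    moreover have "f p y = - (\<delta> * (\<Sum>j\<in>R. real (p j)) + (\<Sum>i\<in>N. deviation R \<delta> (v i) (b i) p))" for p
      unfolding f_def using y_sum by simp
    ultimately have "- W \<le> (\<Sum>p\<in>C. l p * - (\<delta> * (\<Sum>j\<in>R. real (p j)) +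
        (\<Sum>i\<in>N. deviation R \<delta> (v i) (b i) p)))" using l(3)[of y] by simp
    then show "(\<Sum>p\<in>C. l p * (\<delta> * (\<Sum>j\<in>R. real (p j)) + (\<Sum>i\<in>N. deviation R \<delta> (v i) (b i) p))) \<le> W"
      by (simp only: mult_minus_right sum_negf neg_le_iff_le)
  qed (use l in auto)
qed

text \<open>The bidder deviates to bidding just above an independent sample \<open>q\<close> of the prices \<open>p\<close>. She
  wins the items of \<open>S\<close> with \<open>p \<le> q\<close>. These and the items with \<open>q \<le> p\<close> cover \<open>S\<close> and have the
  same distribution, so by subadditivity she wins half of \<open>v S\<close> on average.\<close>

lemma deviation_to_sample:
  fixes v :: "'a set \<Rightarrow> real"
  assumes "finite R" and v: "subadditive_valuation R v" and "\<delta> > 0" and S: "S \<subseteq> R"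
    and C: "C = R \<rightarrow>\<^sub>E {..c}" and B: "B = R \<rightarrow>\<^sub>E {..Suc c}"
    and l: "\<And>p. p \<in> C \<Longrightarrow> 0 \<le> l p" "sum l C = 1"
    and e: "\<And>b. b \<in> B \<Longrightarrow> (\<Sum>p\<in>C. l p * deviation R \<delta> v b p) \<le> e"
  shows "v S \<le> 2 * (e + \<delta> * real (card R)) + (\<Sum>j\<in>S. 2 * \<delta> * (\<Sum>p\<in>C. l p * real (p j)))"
proof -
  \<comment> \<open>Winning is strict, so matching the sample takes \<open>Suc\<close>; the extra
    units cost at most \<open>\<delta> * real (card R)\<close>.\<close>
  define b where "b q = (\<lambda>j\<in>R. if j \<in> S then Suc (q j) else 0)" for q :: "'a \<Rightarrow> nat"
  define g where "g q p = v {j \<in> S. p j \<le> q j}" for p q :: "'a \<Rightarrow> nat"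
  have bB: "b q \<in> B" if "q \<in> C" for q using that by (auto simp: b_def B C)
  have win: "{j \<in> R. p j < b q j} = {j \<in> S. p j \<le> q j}" for p q
    using S by (auto simp: b_def)
  have pay: "(\<Sum>j\<in>R. real (b q j)) \<le> (\<Sum>j\<in>S. real (q j)) + real (card R)" for q
  proof -
    have "(\<Sum>j\<in>R. real (b q j)) = (\<Sum>j\<in>S. real (q j) + 1)"
      using S \<open>finite R\<close> by (intro sum.mono_neutral_cong_right) (auto simp: b_def)
    also have "\<dots> \<le> (\<Sum>j\<in>S. real (q j)) + real (card R)"
      using card_mono[OF \<open>finite R\<close> S] by (simp add: sum.distrib)
    finally show ?thesis .
  qed
  have one: "(\<Sum>p\<in>C. l p * g q p) \<le> e + \<delta> * ((\<Sum>j\<in>S. real (q j)) + real (card R))"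
    if "q \<in> C" for q
  proof -
    have "(\<Sum>p\<in>C. l p * deviation R \<delta> v (b q) p) =
        (\<Sum>p\<in>C. l p * g q p) - \<delta> * (\<Sum>j\<in>R. real (b q j))"
      unfolding deviation_def win g_def[symmetric] right_diff_distrib sum_subtractf
        sum_distrib_right[symmetric] l(2) by simp
    then show ?thesis
      using e[OF bB[OF that]] mult_left_mono[OF pay[of q], of \<delta>] \<open>\<delta> > 0\<close> by linarith
  qed
  have cover: "v S \<le> g q p + g p q" for p q
  proof -
    have "v (X \<union> Y) \<le> v X + v Y" if "X \<subseteq> R" "Y \<subseteq> R" for X Y
      using v that by (simp add: subadditive_valuation_def)
    then have "v ({j \<in> S. p j \<le> q j} \<union> {j \<in> S. q j \<le> p j}) \<le> g q p + g p q"
      using S by (simp add: g_def Collect_conj_eq le_infI1)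
    also have "{j \<in> S. p j \<le> q j} \<union> {j \<in> S. q j \<le> p j} = S" by auto
    finally show ?thesis .
  qed
  \<comment> \<open>Renaming the two independent samples turns the expectation of
    \<open>g q p\<close> into that of \<open>g p q\<close>, so both halves of the cover contribute
    the same \<open>T\<close>.\<close>
  define T where "T = (\<Sum>q\<in>C. l q * (\<Sum>p\<in>C. l p * g q p))"
  have T': "T = (\<Sum>q\<in>C. l q * (\<Sum>p\<in>C. l p * g p q))"
    unfolding T_def sum_distrib_left
    using sum.swap[of "\<lambda>q p. l q * (l p * g q p)" C C] by (simp only: mult.left_commute)
  have "v S = (\<Sum>q\<in>C. l q * (\<Sum>p\<in>C. l p * v S))"
    by (simp only: sum_distrib_right[symmetric] l(2) mult_1)
  also have "\<dots> \<le> (\<Sum>q\<in>C. l q * (\<Sum>p\<in>C. l p * (g q p + g p q)))"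
    using cover l(1) by (intro sum_mono mult_left_mono) auto
  also have "\<dots> = 2 * T"
    unfolding distrib_left sum.distrib T_def[symmetric] T'[symmetric] by simp
  finally have "v S \<le> 2 * T" .
  have "T \<le> (\<Sum>q\<in>C. l q * (e + \<delta> * ((\<Sum>j\<in>S. real (q j)) + real (card R))))"
    unfolding T_def using one l(1) by (intro sum_mono mult_left_mono) auto
  also have "\<dots> = (\<Sum>q\<in>C. l q * (e + \<delta> * real (card R)) + \<delta> * (l q * (\<Sum>j\<in>S. real (q j))))"
    by (rule sum.cong) (simp_all add: algebra_simps)
  also have "\<dots> = (\<Sum>q\<in>C. l q) * (e + \<delta> * real (card R)) +
      \<delta> * (\<Sum>q\<in>C. l q * (\<Sum>j\<in>S. real (q j)))"
    by (simp only: sum.distrib sum_distrib_right sum_distrib_left)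
  also have "\<dots> = e + \<delta> * real (card R) + \<delta> * (\<Sum>q\<in>C. \<Sum>j\<in>S. l q * real (q j))"
    by (simp only: l(2) mult_1 sum_distrib_left)
  also have "(\<Sum>q\<in>C. \<Sum>j\<in>S. l q * real (q j)) = (\<Sum>j\<in>S. \<Sum>q\<in>C. l q * real (q j))"
    by (rule sum.swap)
  finally have "2 * T \<le> 2 * (e + \<delta> * real (card R)) + 2 * \<delta> * (\<Sum>j\<in>S. \<Sum>q\<in>C. l q * real (q j))"
    by simp
  with \<open>v S \<le> 2 * T\<close> show ?thesis by (simp only: sum_distrib_left[symmetric])
qed

text \<open>Prices and utilities are twice an expectation because a bid that copies a price sample
  secures only half of \<open>v i S\<close> on average. \<open>u i\<close> comes from the best
  expected utility \<open>e i\<close> of a deviation; inserting all maximizers at once into the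
  bound for \<open>l\<close> controls the total.\<close>

lemma supporting_prices:
  fixes v :: "nat \<Rightarrow> 'a set \<Rightarrow> real"
  assumes "finite N" "finite R" and v: "\<And>i. i \<in> N \<Longrightarrow> subadditive_valuation R (v i)"
    and W: "\<And>A. A \<in> alloc N R \<Longrightarrow> (\<Sum>i\<in>N. v i (A i)) \<le> W" and "\<epsilon> > 0"
  obtains p u where "\<And>j. j \<in> R \<Longrightarrow> 0 \<le> p j" "\<And>i. i \<in> N \<Longrightarrow> 0 \<le> u i"
    "\<And>i S. i \<in> N \<Longrightarrow> S \<subseteq> R \<Longrightarrow> v i S \<le> u i + sum p S" "sum u N + sum p R \<le> 2 * W + \<epsilon>"
proof -
  \<comment> \<open>Chosen so that the terms \<open>2 * \<delta> * real (card R)\<close> of all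
    bidders add up to at most \<open>\<epsilon>\<close>; the \<open>+ 1\<close> keeps the
    denominator positive.\<close>
  define \<delta> where "\<delta> = \<epsilon> / (2 * real (card N * card R) + 1)"
  have "0 < 2 * real (card N * card R) + 1" by (rule add_nonneg_pos) simp_all
  then have \<delta>: "\<delta> > 0" "2 * real (card N * card R) * \<delta> \<le> \<epsilon>"
    using \<open>\<epsilon> > 0\<close> by (simp_all add: \<delta>_def field_simps)
  \<comment> \<open>Large enough that a bid of \<open>Suc c\<close> on one item costs at least what
    all items are worth to any bidder.\<close>
  define c where "c = nat \<lceil>(\<Sum>i\<in>N. v i R) / \<delta>\<rceil>"
  have cap: "v i R \<le> \<delta> * real (Suc c)" if i: "i \<in> N" for i
  proof -
    have "v i R \<le> (\<Sum>i\<in>N. v i R)"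
      using i \<open>finite N\<close> v by (intro member_le_sum) (auto intro: subadditive_valuation_nonneg)
    moreover have "(\<Sum>i\<in>N. v i R) / \<delta> \<le> real (Suc c)" unfolding c_def by linarith
    ultimately show ?thesis using \<delta>(1) by (simp add: divide_simps mult.commute)
  qed
  \<comment> \<open>Prices are sums of \<open>card N\<close> bids of at most \<open>c\<close> each;
    deviations reach one unit further so that every price can be outbid.\<close>
  define C where "C = R \<rightarrow>\<^sub>E {..card N * c}"
  define B where "B = R \<rightarrow>\<^sub>E {..Suc (card N * c)}"
  obtain l where l: "\<And>p. p \<in> C \<Longrightarrow> 0 \<le> l p" "sum l C = 1"
    "\<And>b. b \<in> N \<rightarrow> B \<Longrightarrow>
       (\<Sum>p\<in>C. l p * (\<delta> * (\<Sum>j\<in>R. real (p j)) + (\<Sum>i\<in>N. deviation R \<delta> (v i) (b i) p))) \<le> W"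
    using exists_price_distribution[OF assms(1-4) \<delta>(1) cap C_def B_def] by blast
  define h where "h i b = (\<Sum>p\<in>C. l p * deviation R \<delta> (v i) b p)" for i b
  have finB: "finite B" using \<open>finite R\<close> by (simp add: B_def finite_PiE)
  have "(\<lambda>j\<in>R. 0) \<in> B" by (auto simp: B_def)
  then have ne: "B \<noteq> {}" by blast
  define e where "e i = Max (h i ` B)" for i
  have "\<exists>b\<in>B. e i = h i b" for i
  proof -
    have "e i \<in> h i ` B" unfolding e_def using finB ne by (intro Max_in) auto
    then show ?thesis by blast
  qed
  then obtain b where b: "\<And>i. b i \<in> B" "\<And>i. e i = h i (b i)" by metis
  have e_ge: "h i x \<le> e i" if "x \<in> B" for i x
    unfolding e_def using finB that by (intro Max_ge) auto
  have tot: "\<delta> * (\<Sum>j\<in>R. \<Sum>p\<in>C. l p * real (p j)) + sum e N \<le> W"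
  proof -
    have "(\<Sum>p\<in>C. l p * (\<delta> * (\<Sum>j\<in>R. real (p j)))) = \<delta> * (\<Sum>p\<in>C. \<Sum>j\<in>R. l p * real (p j))"
      unfolding sum_distrib_left by (simp only: mult.left_commute)
    also have "(\<Sum>p\<in>C. \<Sum>j\<in>R. l p * real (p j)) = (\<Sum>j\<in>R. \<Sum>p\<in>C. l p * real (p j))"
      by (rule sum.swap)
    finally show ?thesis
      using l(3)[of b] b(1) unfolding weighted_sum_add_sum h_def[symmetric] b(2) by simp
  qed
  have val: "v i S \<le> 2 * (e i + \<delta> * real (card R)) +
      (\<Sum>j\<in>S. 2 * \<delta> * (\<Sum>p\<in>C. l p * real (p j)))" if "i \<in> N" "S \<subseteq> R" for i S
    by (rule deviation_to_sample[OF \<open>finite R\<close> v[OF that(1)] \<delta>(1) that(2) C_def B_def l(1,2)])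
      (use e_ge in \<open>auto simp: h_def\<close>)
  show thesis
  proof (rule that[of "\<lambda>j. 2 * \<delta> * (\<Sum>p\<in>C. l p * real (p j))" "\<lambda>i. 2 * (e i + \<delta> * real (card R))"])
    show "0 \<le> 2 * (e i + \<delta> * real (card R))" if i: "i \<in> N" for i
      using val[OF i, of "{}"] v[OF i] by (simp add: subadditive_valuation_def)
    show "(\<Sum>i\<in>N. 2 * (e i + \<delta> * real (card R))) + (\<Sum>j\<in>R. 2 * \<delta> * (\<Sum>p\<in>C. l p * real (p j)))
        \<le> 2 * W + \<epsilon>"
      using tot \<delta>(2)
      by (simp add: sum_distrib_left[symmetric] sum_distrib_right[symmetric] sum.distrib algebra_simps)
  qed (use \<delta>(1) l(1) val in \<open>auto intro!: mult_nonneg_nonneg sum_nonneg\<close>)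
qed

section \<open>Protocols for subadditive bidders\<close>

text \<open>The bidders repeatedly halve the support of the public distribution \<open>l\<close>, announcing their
  conditional expectations rounded down to multiples of \<open>\<theta>\<close>.\<close>

lemma solvable_conditional_expectation:
  fixes g :: "nat \<Rightarrow> 'x \<Rightarrow> 'h \<Rightarrow> real"
  assumes "finite N" "N \<subseteq> I" "\<theta> > 0" and c: "(nat \<lfloor>M / \<theta>\<rfloor> + 1)\<^sup>2 \<le> 2 ^ c"
    and "finite H" "card H \<le> 2 ^ d" "\<And>A. A \<in> H \<Longrightarrow> 0 \<le> l A" "sum l H = 1"
    and "\<And>v i A. v \<in> D \<Longrightarrow> i \<in> N \<Longrightarrow> A \<in> H \<Longrightarrow> 0 \<le> g i (v i) A \<and> g i (v i) A \<le> M"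
    and "\<And>v. v \<in> D \<Longrightarrow> \<tau> \<le> (\<Sum>A\<in>H. l A * (\<Sum>i\<in>N. g i (v i) A))"
  shows "solvable I (d * (card N * c)) D
    (\<lambda>v A. A \<in> H \<and> \<tau> - real (d * card N) * \<theta> \<le> (\<Sum>i\<in>N. g i (v i) A))"
  using assms(5-10)
proof (induction d arbitrary: H l D \<tau>)
  case 0
  have "H \<noteq> {}" using 0(4) by auto
  then have "card H = 1" using 0(1,2) by (simp add: le_Suc_eq)
  then obtain A where "H = {A}" by (auto simp: card_1_singleton_iff)
  then show ?case using 0(4,6) by (intro solvable_output[of _ _ A]) auto
next
  case (Suc d)
  obtain H1 H2 where H: "H = H1 \<union> H2" "H1 \<inter> H2 = {}" "card H1 \<le> 2 ^ d" "card H2 \<le> 2 ^ d"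
    using finite_halves[OF Suc.prems(1,2)] by blast
  have fin: "finite H1" "finite H2" using Suc.prems(1) H by auto
  have split: "sum f H = sum f H1 + sum f H2" for f :: "'h \<Rightarrow> real"
    unfolding H(1) using fin H(2) by (intro sum.union_disjoint)
  define G where "G v A = (\<Sum>i\<in>N. g i (v i) A)" for v A
  define nb where "nb = card N * c"
  define loss where "loss = real (card N) * \<theta>"
  have loss: "0 \<le> loss" using \<open>\<theta> > 0\<close> by (simp add: loss_def)
  have bound: "0 \<le> g i (v i) A \<and> g i (v i) A \<le> M" if "v \<in> D" "i \<in> N" "A \<in> H" for v i A
    using Suc.prems(5) that .
  \<comment> \<open>Bidder \<open>i\<close>'s share of the conditional expectation given the half
    \<open>F\<close>. By linearity the shares add up over the bidders, so each can compute hers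
    alone.\<close>
  define a where "a F i x = (\<Sum>A\<in>F. l A * g i x A) / sum l F" for F i x
  have a_sum: "(\<Sum>i\<in>N. a F i (v i)) = (\<Sum>A\<in>F. l A * G v A) / sum l F" for F v
  proof -
    have "(\<Sum>i\<in>N. \<Sum>A\<in>F. l A * g i (v i) A) = (\<Sum>A\<in>F. \<Sum>i\<in>N. l A * g i (v i) A)"
      by (rule sum.swap)
    then show ?thesis by (simp add: a_def G_def sum_divide_distrib[symmetric] sum_distrib_left)
  qed
  have recurse: "solvable I (d * nb) D' (\<lambda>v A. A \<in> H \<and> \<tau> - real (Suc d * card N) * \<theta> \<le> G v A)"
    if F: "F \<subseteq> H" "card F \<le> 2 ^ d" "0 < sum l F" and D': "D' \<subseteq> D"
      and avg: "\<And>v. v \<in> D' \<Longrightarrow> \<tau> - loss \<le> (\<Sum>A\<in>F. l A * G v A) / sum l F" for F D'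
  proof -
    have "solvable I (d * (card N * c)) D'
      (\<lambda>v A. A \<in> F \<and> (\<tau> - loss) - real (d * card N) * \<theta> \<le> (\<Sum>i\<in>N. g i (v i) A))"
    proof (rule Suc.IH[where l = "\<lambda>A. l A / sum l F"])
      show "finite F" using F Suc.prems(1) by (auto intro: finite_subset)
      show "\<tau> - loss \<le> (\<Sum>A\<in>F. l A / sum l F * (\<Sum>i\<in>N. g i (v i) A))" if "v \<in> D'" for v
        using avg[OF that] by (simp add: G_def sum_divide_distrib)
      show "0 \<le> g i (v i) A \<and> g i (v i) A \<le> M" if "v \<in> D'" "i \<in> N" "A \<in> F" for v i A
        using that F D' by (intro bound) auto
    qed (use F D' Suc.prems in \<open>auto simp: sum_divide_distrib[symmetric]\<close>)
    then show ?thesis unfolding nb_def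
      by (rule solvable_mono) (use F in \<open>auto simp: G_def loss_def algebra_simps\<close>)
  qed
  have nonneg: "0 \<le> sum l H1" "0 \<le> sum l H2"
    using Suc.prems(3) H by (auto intro!: sum_nonneg)
  have total: "\<tau> \<le> (\<Sum>A\<in>H1. l A * G v A) + (\<Sum>A\<in>H2. l A * G v A)" if "v \<in> D" for v
    using Suc.prems(6)[OF that] by (simp add: G_def split)
  have null: "(\<Sum>A\<in>F. l A * G v A) = 0" if "sum l F = 0" "F \<subseteq> H" for F v
  proof -
    have "\<forall>A\<in>F. l A = 0"
      using that Suc.prems(1,3) by (subst sum_nonneg_eq_0_iff[symmetric]) (auto intro: finite_subset)
    then show ?thesis by simp
  qed
  have "solvable I (card N * c + d * nb) D
      (\<lambda>v A. A \<in> H \<and> \<tau> - real (Suc d * card N) * \<theta> \<le> G v A)"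
  proof (cases "sum l H1 = 0 \<or> sum l H2 = 0")
    \<comment> \<open>Conditioning on a half of weight zero makes no sense; the other half then
      carries all the weight, and this round passes without any message.\<close>
    case True
    then obtain E F where EF: "{E, F} = {H1, H2}" "sum l E = 0" by (metis insert_commute)
    have sub: "E \<subseteq> H" "F \<subseteq> H" "card F \<le> 2 ^ d" using EF(1) H by (auto simp: doubleton_eq_iff)
    have "sum l F = 1" using EF split[of l] Suc.prems(4) by (auto simp: doubleton_eq_iff)
    moreover have "\<tau> \<le> (\<Sum>A\<in>F. l A * G v A)" if "v \<in> D" for v
      using total[OF that] null[OF EF(2) sub(1), of v] EF(1) by (auto simp: doubleton_eq_iff)
    then have "\<tau> - loss \<le> (\<Sum>A\<in>F. l A * G v A)" if "v \<in> D" for v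
      using loss that by fastforce
    ultimately have "solvable I (d * nb) D (\<lambda>v A. A \<in> H \<and> \<tau> - real (Suc d * card N) * \<theta> \<le> G v A)"
      by (intro recurse[of F]) (use sub in auto)
    then show ?thesis by (rule solvable_mono) auto
  next
    case False
    then have pos: "0 < sum l H1" "0 < sum l H2" using nonneg by auto
    define K where "K = nat \<lfloor>M / \<theta>\<rfloor>"
    define r where "r F i x = nat \<lfloor>a F i x / \<theta>\<rfloor>" for F i x
    have a_bounds: "0 \<le> a F i (v i)" "a F i (v i) \<le> M"
      if "v \<in> D" "i \<in> N" "F \<subseteq> H" "0 < sum l F" for F i v
    proof -
      show "0 \<le> a F i (v i)" unfolding a_def
        using that bound Suc.prems(3) by (intro divide_nonneg_pos sum_nonneg mult_nonneg_nonneg) auto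
      have "(\<Sum>A\<in>F. l A * g i (v i) A) \<le> (\<Sum>A\<in>F. l A * M)"
        using that bound Suc.prems(3) by (intro sum_mono mult_left_mono) auto
      then show "a F i (v i) \<le> M"
        using that unfolding sum_distrib_right[symmetric] by (simp add: a_def divide_simps mult.commute)
    qed
    have r_le: "r F i (v i) \<le> K" if "v \<in> D" "i \<in> N" "F \<subseteq> H" "0 < sum l F" for F i v
      unfolding r_def K_def using a_bounds[OF that] \<open>\<theta> > 0\<close>
      by (intro nat_mono floor_mono divide_right_mono) auto
    have r_approx: "\<theta> * real (r F i (v i)) \<le> a F i (v i)" "a F i (v i) \<le> \<theta> * real (r F i (v i)) + \<theta>"
      if "v \<in> D" "i \<in> N" "F \<subseteq> H" "0 < sum l F" for F i v
    proof -
      have "0 \<le> a F i (v i) / \<theta>" using a_bounds(1)[OF that] \<open>\<theta> > 0\<close> by simp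
      then have "real (r F i (v i)) \<le> a F i (v i) / \<theta>" "a F i (v i) / \<theta> \<le> real (r F i (v i)) + 1"
        unfolding r_def by linarith+
      then show "\<theta> * real (r F i (v i)) \<le> a F i (v i)" "a F i (v i) \<le> \<theta> * real (r F i (v i)) + \<theta>"
        using \<open>\<theta> > 0\<close> by (simp_all add: field_simps)
    qed
    show ?thesis
    \<comment> \<open>Each bidder announces her share for both halves, hence the square in the bound
      on \<open>2 ^ c\<close>.\<close>
    proof (rule solvable_announce_all[where g = "\<lambda>i x. (r H1 i x, r H2 i x)" and B = "{..K} \<times> {..K}"])
      show "card ({..K} \<times> {..K}) \<le> 2 ^ c" using c by (simp add: K_def power2_eq_square)
      fix h :: "nat \<Rightarrow> nat \<times> nat"
      define D' where "D' = {v \<in> D. \<forall>i\<in>N. (r H1 i (v i), r H2 i (v i)) = h i}"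
      \<comment> \<open>The half \<open>E\<close> with the larger announced total is kept: its
        average is at most \<open>loss\<close> below that of \<open>F\<close>, and
        \<open>\<tau>\<close> is at most the weighted mean of the two.\<close>
      have approx: "\<tau> - loss \<le> (\<Sum>A\<in>E. l A * G v A) / sum l E"
        if EF: "{E, F} = {H1, H2}" and v: "v \<in> D'"
          and le: "(\<Sum>i\<in>N. r F i (v i)) \<le> (\<Sum>i\<in>N. r E i (v i))" for E F v
      proof -
        have vD: "v \<in> D" using v by (simp add: D'_def)
        have E: "E \<subseteq> H" "0 < sum l E" and F: "F \<subseteq> H" "0 < sum l F"
          using EF pos H by (auto simp: doubleton_eq_iff)
        have one: "sum l E + sum l F = 1"
          using EF split[of l] Suc.prems(4) by (auto simp: doubleton_eq_iff)
        define x where "x = (\<Sum>A\<in>E. l A * G v A) / sum l E"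
        define y where "y = (\<Sum>A\<in>F. l A * G v A) / sum l F"
        have "\<tau> \<le> sum l E * x + sum l F * y"
          using total[OF vD] EF E F by (auto simp: doubleton_eq_iff x_def y_def)
        moreover have "y \<le> x + loss"
        proof -
          have "y = (\<Sum>i\<in>N. a F i (v i))" by (simp add: y_def a_sum)
          also have "\<dots> \<le> (\<Sum>i\<in>N. \<theta> * real (r F i (v i)) + \<theta>)"
            using r_approx(2)[OF vD _ F] by (intro sum_mono) auto
          also have "\<dots> = \<theta> * real (\<Sum>i\<in>N. r F i (v i)) + loss"
            by (simp add: sum.distrib loss_def sum_distrib_left)
          also have "\<dots> \<le> \<theta> * real (\<Sum>i\<in>N. r E i (v i)) + loss"
            using le \<open>\<theta> > 0\<close>
            by (intro add_right_mono mult_left_mono) (simp_all only: of_nat_le_iff less_imp_le)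
          also have "\<dots> = (\<Sum>i\<in>N. \<theta> * real (r E i (v i))) + loss" by (simp add: sum_distrib_left)
          also have "\<dots> \<le> (\<Sum>i\<in>N. a E i (v i)) + loss"
            using r_approx(1)[OF vD _ E] by (intro add_right_mono sum_mono) auto
          also have "\<dots> = x + loss" by (simp add: x_def a_sum)
          finally show ?thesis .
        qed
        then have "sum l F * y \<le> sum l F * x + sum l F * loss"
          using F mult_left_mono[of y "x + loss" "sum l F"] by (simp add: distrib_left)
        moreover have "sum l F * loss \<le> loss"
          using one E F loss by (intro mult_left_le_one_le) auto
        moreover have "sum l E * x + sum l F * x = x"
          by (simp only: distrib_right[symmetric] one mult_1)
        ultimately show ?thesis unfolding x_def[symmetric] by linarith
      qed
      have sums: "(\<Sum>i\<in>N. r H1 i (v i)) = (\<Sum>i\<in>N. fst (h i))"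
          "(\<Sum>i\<in>N. r H2 i (v i)) = (\<Sum>i\<in>N. snd (h i))" if "v \<in> D'" for v
        using that unfolding D'_def by (auto intro!: sum.cong simp: prod_eq_iff)
      have "solvable I (d * nb) D' (\<lambda>v A. A \<in> H \<and> \<tau> - real (Suc d * card N) * \<theta> \<le> G v A)"
      proof (cases "(\<Sum>i\<in>N. snd (h i)) \<le> (\<Sum>i\<in>N. fst (h i))")
        case True
        then show ?thesis using approx[of H1 H2] sums pos H
          by (intro recurse[of H1]) (auto simp: D'_def)
      next
        case False
        then show ?thesis using approx[of H2 H1] sums pos H
          by (intro recurse[of H2]) (auto simp: D'_def)
      qed
      then show "solvable I (d * nb) {v \<in> D. \<forall>i\<in>N. (r H1 i (v i), r H2 i (v i)) = h i}
        (\<lambda>v A. A \<in> H \<and> \<tau> - real (Suc d * card N) * \<theta> \<le> G v A)" by (simp add: D'_def)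
    qed (use assms(1,2) r_le pos H in auto)
  qed
  then show ?case by (simp add: nb_def G_def)
qed

section \<open>Price certificates and their refutation\<close>

definition bounded_subadditive :: "'a set \<Rightarrow> nat \<Rightarrow> ('a set \<Rightarrow> nat) \<Rightarrow> bool" where
  "bounded_subadditive R M u \<longleftrightarrow>
     subadditive_valuation R (\<lambda>S. real (u S)) \<and> (\<forall>S\<subseteq>R. u S \<le> M)"

text \<open>Prices and utilities are
  multiples of \<open>1 / L\<close>; the certificates considered have total less than \<open>t\<close>.\<close>

definition certificates ::
    "nat set \<Rightarrow> 'a set \<Rightarrow> nat \<Rightarrow> nat \<Rightarrow> (('a \<Rightarrow> nat) \<times> (nat \<Rightarrow> nat)) set" where
  "certificates N R L t =
     {(p, u). p \<in> R \<rightarrow>\<^sub>E {..<L * t} \<and> u \<in> N \<rightarrow>\<^sub>E {..<L * t} \<and> sum p R + sum u N < L * t}"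

text \<open>The pair \<open>(i, S)\<close> is chosen before the profile \<open>v\<close>: a
  refutation must be visible from the transcript, and it then is a linear constraint on profiles, as
  the convexity argument requires.\<close>

definition refuted ::
    "(nat \<Rightarrow> 'x \<Rightarrow> 'a set \<Rightarrow> nat) \<Rightarrow> nat set \<Rightarrow> 'a set \<Rightarrow> nat \<Rightarrow> (nat \<Rightarrow> 'x) set \<Rightarrow>
      (('a \<Rightarrow> nat) \<times> (nat \<Rightarrow> nat)) \<Rightarrow> bool" where
  "refuted val N R L D = (\<lambda>(p, u). \<exists>i\<in>N. \<exists>S\<subseteq>R. \<forall>v\<in>D. u i + sum p S < L * val i (v i) S)"

lemma certificates_finite: "finite N \<Longrightarrow> finite R \<Longrightarrow> finite (certificates N R L t)"
  unfolding certificates_def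
  by (rule finite_subset[of _ "(R \<rightarrow>\<^sub>E {..<L * t}) \<times> (N \<rightarrow>\<^sub>E {..<L * t})"]) (auto simp: finite_PiE)

lemma certificates_card:
  assumes "finite N" "finite R"
  shows "card (certificates N R L t) \<le> (L * t) ^ (card R + card N)"
proof -
  have "card (certificates N R L t) \<le> card ((R \<rightarrow>\<^sub>E {..<L * t}) \<times> (N \<rightarrow>\<^sub>E {..<L * t}))"
    unfolding certificates_def using assms by (intro card_mono) (auto simp: finite_PiE)
  also have "\<dots> = (L * t) ^ (card R + card N)"
    using assms by (simp add: card_cartesian_product card_PiE power_add)
  finally show ?thesis .
qed

text \<open>Supporting prices for \<open>W = t/2 - 1/4\<close> and \<open>\<epsilon> = 1/8\<close>
  total at most \<open>t - 3/8\<close>. In units of \<open>1 / L\<close>, rounding up adds at most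
  \<open>card R + card N\<close>, that is \<open>L / 4\<close>, which fits into the slack of
  \<open>3/8 * L\<close>; this dictates \<open>L\<close>.\<close>

lemma nearby_certificate:
  fixes w :: "nat \<Rightarrow> 'a set \<Rightarrow> real"
  assumes "finite N" "finite R" "N \<noteq> {}" and w: "\<And>i. i \<in> N \<Longrightarrow> subadditive_valuation R (w i)"
    and L: "L = 4 * (card R + card N)"
    and W: "\<And>A. A \<in> alloc N R \<Longrightarrow> (\<Sum>i\<in>N. w i (A i)) \<le> real t / 2 - 1 / 4"
  shows "\<exists>(p, u)\<in>certificates N R L t. \<forall>i\<in>N. \<forall>S\<subseteq>R. real L * w i S \<le> real (u i + sum p S)"
proof -
  obtain p u where p: "\<And>j. j \<in> R \<Longrightarrow> 0 \<le> p j" and u: "\<And>i. i \<in> N \<Longrightarrow> 0 \<le> u i"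
    and val: "\<And>i S. i \<in> N \<Longrightarrow> S \<subseteq> R \<Longrightarrow> w i S \<le> u i + sum p S"
    and tot: "sum u N + sum p R \<le> 2 * (real t / 2 - 1 / 4) + 1 / 8"
    using supporting_prices[OF assms(1,2) w W, of "1 / 8"] by auto
  have n: "1 \<le> card N" using assms(1,3) by (simp add: Suc_leI card_gt_0_iff)
  define rnd where "rnd x = nat \<lceil>real L * x\<rceil>" for x
  have rnd_ge: "real L * x \<le> real (rnd x)" for x unfolding rnd_def by linarith
  have rnd_le: "real (rnd x) \<le> real L * x + 1" if "0 \<le> x" for x
  proof -
    have "0 \<le> real L * x" using that by simp
    then show ?thesis unfolding rnd_def by linarith
  qed
  define p' where "p' = (\<lambda>j\<in>R. rnd (p j))"
  define u' where "u' = (\<lambda>i\<in>N. rnd (u i))"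
  have "real (sum p' R) \<le> (\<Sum>j\<in>R. real L * p j + 1)"
    unfolding of_nat_sum using p rnd_le by (intro sum_mono) (simp add: p'_def)
  then have pR: "real (sum p' R) \<le> real L * sum p R + real (card R)"
    by (simp add: sum.distrib sum_distrib_left)
  have "real (sum u' N) \<le> (\<Sum>j\<in>N. real L * u j + 1)"
    unfolding of_nat_sum using u rnd_le by (intro sum_mono) (simp add: u'_def)
  then have uN: "real (sum u' N) \<le> real L * sum u N + real (card N)"
    by (simp add: sum.distrib sum_distrib_left)
  have "real L * (sum u N + sum p R) \<le> real L * (2 * (real t / 2 - 1 / 4) + 1 / 8)"
    using tot by (intro mult_left_mono) auto
  also have "\<dots> = real L * real t - 3 / 8 * real L" by (simp add: algebra_simps)
  finally have "real L * sum u N + real L * sum p R \<le> real L * real t - 3 / 8 * real L"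
    by (simp add: distrib_left)
  moreover have "real L = 4 * real (card R) + 4 * real (card N)" by (simp add: L)
  ultimately have "real (sum p' R) + real (sum u' N) < real L * real t"
    using pR uN n by linarith
  then have sum_less: "sum p' R + sum u' N < L * t"
    by (metis of_nat_add of_nat_mult of_nat_less_iff)
  have "p' j < L * t" if "j \<in> R" for j
    using member_le_sum[of j R p'] that \<open>finite R\<close> sum_less by simp
  moreover have "u' i < L * t" if "i \<in> N" for i
    using member_le_sum[of i N u'] that \<open>finite N\<close> sum_less by simp
  ultimately have cert: "(p', u') \<in> certificates N R L t"
    using sum_less by (auto simp: certificates_def p'_def u'_def)
  have "real L * w i S \<le> real (u' i + sum p' S)" if "i \<in> N" "S \<subseteq> R" for i S
  proof -
    have "real L * w i S \<le> real L * u i + (\<Sum>j\<in>S. real L * p j)"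
      using val[OF that] mult_left_mono[of _ _ "real L"]
      by (simp add: sum_distrib_left[symmetric] distrib_left[symmetric])
    also have "\<dots> \<le> real (u' i) + (\<Sum>j\<in>S. real (p' j))"
      using that rnd_ge by (intro add_mono sum_mono) (auto simp: u'_def p'_def)
    finally show ?thesis by simp
  qed
  then show ?thesis using cert by blast
qed

text \<open>Once every certificate is refuted, the profiles refuting them in the same way form a convex
  set, and the minimax theorem yields one distribution over allocations that is good for all.\<close>

lemma all_refuted_imp_distribution:
  fixes val :: "nat \<Rightarrow> 'x \<Rightarrow> 'a set \<Rightarrow> nat"
  assumes "finite N" "finite R" "N \<noteq> {}"
    and val: "\<And>v i. v \<in> D \<Longrightarrow> i \<in> N \<Longrightarrow> bounded_subadditive R M (val i (v i))"
    and L: "L = 4 * (card R + card N)"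
    and all: "\<And>c. c \<in> certificates N R L t \<Longrightarrow> refuted val N R L D c"
  shows "\<exists>l. (\<forall>A\<in>alloc N R. 0 \<le> l A) \<and> sum l (alloc N R) = 1 \<and>
    (\<forall>v\<in>D. real t / 2 - 1 / 4 \<le> (\<Sum>A\<in>alloc N R. l A * (\<Sum>i\<in>N. real (val i (v i) (A i)))))"
proof -
  have "\<forall>c\<in>certificates N R L t. \<exists>i S. i \<in> N \<and> S \<subseteq> R \<and>
      (\<forall>v\<in>D. snd c i + sum (fst c) S < L * val i (v i) S)"
    using all unfolding refuted_def case_prod_unfold Bex_def by blast
  then obtain b Z where bZ: "\<And>c. c \<in> certificates N R L t \<Longrightarrow> b c \<in> N \<and> Z c \<subseteq> R \<and>
      (\<forall>v\<in>D. snd c (b c) + sum (fst c) (Z c) < L * val (b c) (v (b c)) (Z c))"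
    by metis
  \<comment> \<open>Integral profiles are not closed under mixing, so \<open>K\<close> admits real
    values. The fixed refutations are strict linear inequalities and survive mixing.\<close>
  define K where "K = {w. (\<forall>i\<in>N. subadditive_valuation R (w i)) \<and>
    (\<forall>c\<in>certificates N R L t. real (snd c (b c) + sum (fst c) (Z c)) < real L * w (b c) (Z c))}"
  define f where "f A w = (\<Sum>i\<in>N. w i (A i))" for A :: "nat \<Rightarrow> 'a set" and w :: "nat \<Rightarrow> 'a set \<Rightarrow> real"
  have "\<exists>l. (\<forall>A\<in>alloc N R. 0 \<le> l A) \<and> sum l (alloc N R) = 1 \<and>
    (\<forall>w\<in>K. real t / 2 - 1 / 4 \<le> (\<Sum>A\<in>alloc N R. l A * f A w))"
  proof (rule minimax_finite[OF finite_alloc[OF assms(1,2)] alloc_nonempty])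
    fix x y s assume xy: "x \<in> K" "y \<in> K" "0 \<le> s" "s \<le> (1::real)"
    define z where "z i S = s * x i S + (1 - s) * y i S" for i S
    have "subadditive_valuation R (z i)" if "i \<in> N" for i
    proof -
      have X: "subadditive_valuation R (x i)" and Y: "subadditive_valuation R (y i)"
        using xy that by (auto simp: K_def)
      have "z i S \<le> z i T" if "S \<subseteq> T" "T \<subseteq> R" for S T
        unfolding z_def using xy(3,4) X Y that
        by (intro add_mono mult_left_mono) (auto simp: subadditive_valuation_def)
      moreover have "z i (S \<union> T) \<le> z i S + z i T" if "S \<subseteq> R" "T \<subseteq> R" for S T
      proof -
        have "z i (S \<union> T) \<le> s * (x i S + x i T) + (1 - s) * (y i S + y i T)"
          unfolding z_def using xy(3,4) X Y that
          by (intro add_mono mult_left_mono) (auto simp: subadditive_valuation_def)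
        then show ?thesis by (simp add: z_def algebra_simps)
      qed
      moreover have "z i {} = 0" using X Y by (simp add: z_def subadditive_valuation_def)
      ultimately show ?thesis by (simp add: subadditive_valuation_def)
    qed
    moreover have "real (snd c (b c) + sum (fst c) (Z c)) < real L * z (b c) (Z c)"
      if "c \<in> certificates N R L t" for c
    proof -
      define q where "q = real (snd c (b c) + sum (fst c) (Z c))"
      have "q < real L * x (b c) (Z c)" "q < real L * y (b c) (Z c)"
        using xy that by (auto simp: K_def q_def)
      then have "s * - (real L * x (b c) (Z c)) + (1 - s) * - (real L * y (b c) (Z c)) < - q"
        using xy by (intro convex_bound_lt) auto
      then show ?thesis unfolding q_def[symmetric] by (simp add: z_def algebra_simps)
    qed
    ultimately have "z \<in> K" by (simp add: K_def)
    moreover have "f A z = s * f A x + (1 - s) * f A y" for A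
      unfolding f_def z_def by (simp add: sum.distrib sum_distrib_left)
    ultimately show "\<exists>z\<in>K. \<forall>A\<in>alloc N R. f A z = s * f A x + (1 - s) * f A y" by blast
  next
    fix w assume w: "w \<in> K"
    \<comment> \<open>If all allocations were worse for \<open>w\<close>, some certificate would
      support \<open>w\<close>, although \<open>w\<close> satisfies the very constraint that refutes
      it.\<close>
    show "\<exists>A\<in>alloc N R. real t / 2 - 1 / 4 \<le> f A w"
    proof (rule ccontr)
      assume "\<not> ?thesis"
      then have "f A w \<le> real t / 2 - 1 / 4" if "A \<in> alloc N R" for A using that by force
      then obtain p u where pu: "(p, u) \<in> certificates N R L t"
          "\<And>i S. i \<in> N \<Longrightarrow> S \<subseteq> R \<Longrightarrow> real L * w i S \<le> real (u i + sum p S)"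
        using nearby_certificate[OF assms(1-3) _ L, of w t] w by (auto simp: K_def f_def)
      have "real (snd (p, u) (b (p, u)) + sum (fst (p, u)) (Z (p, u))) < real L * w (b (p, u)) (Z (p, u))"
        using w pu(1) unfolding K_def by blast
      then show False
        using pu(2)[of "b (p, u)" "Z (p, u)"] bZ[OF pu(1)] by simp
    qed
  qed
  moreover have inK: "(\<lambda>i S. real (val i (v i) S)) \<in> K" if "v \<in> D" for v
  proof -
    have "real (snd c (b c) + sum (fst c) (Z c)) < real L * real (val (b c) (v (b c)) (Z c))"
      if "c \<in> certificates N R L t" for c
    proof -
      have "snd c (b c) + sum (fst c) (Z c) < L * val (b c) (v (b c)) (Z c)"
        using bZ[OF that] \<open>v \<in> D\<close> by blast
      then show ?thesis by (simp only: of_nat_less_iff of_nat_mult[symmetric])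
    qed
    then show ?thesis using val[OF that] by (simp add: K_def bounded_subadditive_def)
  qed
  ultimately obtain l where l: "\<forall>A\<in>alloc N R. 0 \<le> l A" "sum l (alloc N R) = 1"
    "\<And>w. w \<in> K \<Longrightarrow> real t / 2 - 1 / 4 \<le> (\<Sum>A\<in>alloc N R. l A * f A w)" by blast
  have "real t / 2 - 1 / 4 \<le> (\<Sum>A\<in>alloc N R. l A * (\<Sum>i\<in>N. real (val i (v i) (A i))))"
    if "v \<in> D" for v
    using l(3)[OF inK[OF that]] by (simp add: f_def)
  then show ?thesis using l(1,2) by blast
qed

lemma card_alloc:
  assumes "finite N" "finite R"
  shows "card (alloc N R) \<le> 2 ^ (card R * card N)"
proof -
  have "card (alloc N R) \<le> card (N \<rightarrow>\<^sub>E Pow R)"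
    unfolding alloc_def using assms by (intro card_mono) (auto simp: finite_PiE)
  also have "\<dots> = 2 ^ (card R * card N)"
    using assms by (simp add: card_PiE card_Pow power_mult)
  finally show ?thesis .
qed

text \<open>The average starts at \<open>t/2 - 1/4\<close> and rounding loses less than
  \<open>1/4\<close>; integrality does the rest. There are at most
  \<open>2 ^ (card R * card N)\<close> allocations, hence \<open>card R * card N\<close> halvings,
  and \<open>\<theta>\<close> is chosen so that their total loss stays within the budget.\<close>

lemma solvable_all_refuted:
  fixes val :: "nat \<Rightarrow> 'x \<Rightarrow> 'a set \<Rightarrow> nat"
  assumes "finite N" "finite R" "N \<noteq> {}" "N \<subseteq> I"
    and val: "\<And>v i. v \<in> D \<Longrightarrow> i \<in> N \<Longrightarrow> bounded_subadditive R M (val i (v i))"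
    and L: "L = 4 * (card R + card N)"
    and all: "\<And>c. c \<in> certificates N R L t \<Longrightarrow> refuted val N R L D c"
    and c: "(8 * M * (card R * card N * card N + 1) + 1)\<^sup>2 \<le> 2 ^ c"
  shows "solvable I (card R * card N * (card N * c)) D
    (\<lambda>v A. A \<in> alloc N R \<and> t \<le> 2 * (\<Sum>i\<in>N. val i (v i) (A i)))"
proof -
  define s where "s = card R * card N * card N"
  define \<theta> where "\<theta> = 1 / (8 * real (s + 1))"
  have \<theta>: "\<theta> > 0" "real s * \<theta> < 1 / 4" by (simp_all add: \<theta>_def divide_simps add_pos_nonneg)
  have "real M / \<theta> = real (8 * M * (s + 1))" by (simp add: \<theta>_def algebra_simps)
  then have fl: "nat \<lfloor>real M / \<theta>\<rfloor> = 8 * M * (s + 1)" by (simp only: floor_of_nat nat_int)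
  have "\<exists>l. (\<forall>A\<in>alloc N R. 0 \<le> l A) \<and> sum l (alloc N R) = 1 \<and>
    (\<forall>v\<in>D. real t / 2 - 1 / 4 \<le> (\<Sum>A\<in>alloc N R. l A * (\<Sum>i\<in>N. real (val i (v i) (A i)))))"
    by (rule all_refuted_imp_distribution[OF assms(1-3) _ L]) (use val all in auto)
  then obtain l where l: "\<forall>A\<in>alloc N R. 0 \<le> l A" "sum l (alloc N R) = 1"
    "\<forall>v\<in>D. real t / 2 - 1 / 4 \<le> (\<Sum>A\<in>alloc N R. l A * (\<Sum>i\<in>N. real (val i (v i) (A i))))"
    by blast
  have "solvable I (card R * card N * (card N * c)) D
    (\<lambda>v A. A \<in> alloc N R \<and> (real t / 2 - 1 / 4) - real (card R * card N * card N) * \<theta> \<le>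
       (\<Sum>i\<in>N. real (val i (v i) (A i))))"
  proof (rule solvable_conditional_expectation[where g = "\<lambda>i x A. real (val i x (A i))" and l = l and M = "real M"])
    show "(nat \<lfloor>real M / \<theta>\<rfloor> + 1)\<^sup>2 \<le> 2 ^ c" using c unfolding fl s_def .
    show "0 \<le> real (val i (v i) (A i)) \<and> real (val i (v i) (A i)) \<le> real M"
      if "v \<in> D" "i \<in> N" "A \<in> alloc N R" for v i A
      using val[OF that(1,2)] that(2,3) by (auto simp: bounded_subadditive_def alloc_def)
  qed (use assms(1,2,4) l \<theta> in \<open>auto intro: finite_alloc card_alloc\<close>)
  then show ?thesis
  proof (rule solvable_mono)
    fix v A
    assume *: "A \<in> alloc N R \<and> (real t / 2 - 1 / 4) - real (card R * card N * card N) * \<theta> \<le>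
       (\<Sum>i\<in>N. real (val i (v i) (A i)))"
    then have "real t / 2 - 1 / 4 - 1 / 4 < real (\<Sum>i\<in>N. val i (v i) (A i))"
      using \<theta>(2) by (simp add: s_def)
    then have "real t < real (2 * (\<Sum>i\<in>N. val i (v i) (A i)) + 1)" by simp
    then have "t < 2 * (\<Sum>i\<in>N. val i (v i) (A i)) + 1" by (simp only: of_nat_less_iff)
    then show "A \<in> alloc N R \<and> t \<le> 2 * (\<Sum>i\<in>N. val i (v i) (A i))" using * by simp
  qed auto
qed

lemma solvable_map:
  assumes "solvable I d D R'" "\<And>v a. v \<in> D \<Longrightarrow> R' v a \<Longrightarrow> R v (f a)"
  shows "solvable I d D R"
proof -
  have "solvable I (d + 0) D R"
    by (rule solvable_bind[OF assms(1)]) (use assms(2) in \<open>auto intro: solvable_output\<close>)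
  then show ?thesis by simp
qed

section \<open>Deciding a welfare threshold\<close>

text \<open>A gap problem: both kinds of answer are legitimate when the optimum lies in
  \<open>[t/2, t)\<close>.\<close>

definition threshold_answer ::
    "(nat \<Rightarrow> 'x \<Rightarrow> 'a set \<Rightarrow> nat) \<Rightarrow> nat set \<Rightarrow> 'a set \<Rightarrow> nat \<Rightarrow> (nat \<Rightarrow> 'x) \<Rightarrow>
      (nat \<Rightarrow> 'a set) option \<Rightarrow> bool" where
  "threshold_answer val N R t v z = (case z of
     None \<Rightarrow> \<forall>A\<in>alloc N R. (\<Sum>i\<in>N. val i (v i) (A i)) < t
   | Some A \<Rightarrow> A \<in> alloc N R \<and> t \<le> 2 * (\<Sum>i\<in>N. val i (v i) (A i)))"

text \<open>An allocation of welfare at least \<open>t\<close> refutes every certificate, so one of its bundles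
  refutes a \<open>1 / n\<close> fraction of those not yet refuted; its owner announces it.\<close>

lemma solvable_threshold:
  fixes val :: "nat \<Rightarrow> 'x \<Rightarrow> 'a set \<Rightarrow> nat"
  assumes "finite N" "finite R" "N \<noteq> {}" "N \<subseteq> I"
    and val: "\<And>v i. v \<in> D \<Longrightarrow> i \<in> N \<Longrightarrow> bounded_subadditive R M (val i (v i))"
    and L: "L = 4 * (card R + card N)"
    and c: "2 ^ card R * (M + 1) + 1 \<le> 2 ^ c"
    and c': "(8 * M * (card R * card N * card N + 1) + 1)\<^sup>2 \<le> 2 ^ c'"
    and live: "real (card {x \<in> certificates N R L t. \<not> refuted val N R L D x}) *
      (1 - 1 / real (card N)) ^ r < 1"
  shows "solvable I (r * (card N * c) + card R * card N * (card N * c')) D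
    (threshold_answer val N R t)"
  using val live
proof (induction r arbitrary: D)
  case 0
  have "finite {x \<in> certificates N R L t. \<not> refuted val N R L D x}"
    using certificates_finite[OF assms(1,2)] by simp
  moreover have "card {x \<in> certificates N R L t. \<not> refuted val N R L D x} = 0"
    using 0(2) by simp
  ultimately have "{x \<in> certificates N R L t. \<not> refuted val N R L D x} = {}"
    by (simp only: card_0_eq)
  then have all: "refuted val N R L D x" if "x \<in> certificates N R L t" for x
    using that by blast
  have "solvable I (card R * card N * (card N * c')) D
      (\<lambda>v A. A \<in> alloc N R \<and> t \<le> 2 * (\<Sum>i\<in>N. val i (v i) (A i)))"
    by (rule solvable_all_refuted[OF assms(1-4) _ L _ c']) (use 0(1) all in auto)
  then show ?case
    unfolding mult_0 add_0
    by (rule solvable_map[where f = Some]) (simp add: threshold_answer_def)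
next
  case (Suc r)
  define n where "n = card N"
  have n: "n > 0" using assms(1,3) by (simp add: n_def card_gt_0_iff)
  define U where "U = {x \<in> certificates N R L t. \<not> refuted val N R L D x}"
  have finU: "finite U" using certificates_finite[OF assms(1,2)] by (simp add: U_def)
  define kill where "kill i S a = {x \<in> U. snd x i + sum (fst x) S < L * a}" for i :: nat and S and a :: nat
  \<comment> \<open>Announcing the value of a good bundle refutes at least a \<open>1 / n\<close>
    fraction of the remaining certificates \<open>U\<close>.\<close>
  define good where "good i x S \<longleftrightarrow> S \<subseteq> R \<and> card U \<le> n * card (kill i S (val i x S))" for i x S
  define g where "g i x = (if \<exists>S. good i x S then
      Some (SOME S. good i x S, val i x (SOME S. good i x S)) else None)" for i x
  have g_Some: "good i x S \<and> val i x S = a" if "g i x = Some (S, a)" for i x S a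
  proof -
    have ex: "\<exists>S. good i x S"
    proof (rule ccontr)
      assume "\<nexists>S. good i x S"
      then have "g i x = None" unfolding g_def by (rule if_not_P)
      then show False using that by simp
    qed
    have "g i x = Some (SOME S. good i x S, val i x (SOME S. good i x S))"
      unfolding g_def using ex by (rule if_P)
    then have "S = (SOME S. good i x S)" "a = val i x (SOME S. good i x S)"
      using that by simp_all
    then show ?thesis using someI_ex[OF ex] by blast
  qed
  define d where "d = r * (card N * c) + card R * card N * (card N * c')"
  have "solvable I (card N * c + d) D (threshold_answer val N R t)"
  proof (rule solvable_announce_all[where g = g and B = "insert None (Some ` (Pow R \<times> {..M}))"])
    have "card (insert None (Some ` (Pow R \<times> {..M}))) \<le> Suc (card (Some ` (Pow R \<times> {..M})))"
      by (rule card_insert_le_m1) auto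
    also have "card (Some ` (Pow R \<times> {..M})) = 2 ^ card R * (M + 1)"
      using assms(2) by (simp add: card_image card_cartesian_product card_Pow)
    finally show "card (insert None (Some ` (Pow R \<times> {..M}))) \<le> 2 ^ c" using c by simp
    show "g i (v i) \<in> insert None (Some ` (Pow R \<times> {..M}))" if "v \<in> D" "i \<in> N" for v i
    proof (cases "g i (v i)")
      case (Some z)
      then obtain S a where "g i (v i) = Some (S, a)" by (cases z) auto
      then show ?thesis
        using g_Some[of i "v i" S a] Suc.prems(1)[OF that]
        by (auto simp: good_def bounded_subadditive_def)
    qed simp
    fix h :: "nat \<Rightarrow> ('a set \<times> nat) option"
    define D' where "D' = {v \<in> D. \<forall>i\<in>N. g i (v i) = h i}"
    have "solvable I d D' (threshold_answer val N R t)"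
    \<comment> \<open>If no bidder has a good bundle, no allocation reaches \<open>t\<close>. An
      empty \<open>D'\<close> is set aside because facts about an announced pair are read off a
      witness \<open>v0\<close>.\<close>
    proof (cases "D' = {} \<or> (\<forall>i\<in>N. h i = None)")
      case False
      then obtain v0 i S a where v0: "v0 \<in> D'" and i: "i \<in> N" and h: "h i = Some (S, a)" by auto
      have D'a: "val i (v i) S = a" if "v \<in> D'" for v
        using that i h g_Some[of i "v i" S a] by (auto simp: D'_def)
      have "good i (v0 i) S" using v0 i h g_Some[of i "v0 i" S a] by (auto simp: D'_def)
      then have S: "S \<subseteq> R" "card U \<le> n * card (kill i S a)"
        using D'a[OF v0] by (auto simp: good_def)
      let ?U' = "{x \<in> certificates N R L t. \<not> refuted val N R L D' x}"
      have "?U' \<subseteq> U - kill i S a"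
      proof
        fix x assume x: "x \<in> ?U'"
        have "\<not> refuted val N R L D x"
          using x unfolding refuted_def D'_def case_prod_unfold by blast
        moreover have "x \<notin> kill i S a"
        proof
          assume "x \<in> kill i S a"
          then have "\<forall>v\<in>D'. snd x i + sum (fst x) S < L * val i (v i) S"
            using D'a by (simp add: kill_def)
          then have "refuted val N R L D' x"
            unfolding refuted_def case_prod_unfold using i S(1) by blast
          then show False using x by simp
        qed
        ultimately show "x \<in> U - kill i S a" using x by (simp add: U_def)
      qed
      then have "card ?U' \<le> card (U - kill i S a)" using finU by (intro card_mono) auto
      also have "\<dots> = card U - card (kill i S a)"
        using finU by (intro card_Diff_subset) (auto simp: kill_def intro: finite_subset)
      finally have "card ?U' + card (kill i S a) \<le> card U"
        using card_mono[OF finU, of "kill i S a"] by (simp add: kill_def)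
      then have "real (card ?U') + real (card (kill i S a)) \<le> real (card U)"
        by (simp only: of_nat_add[symmetric] of_nat_le_iff)
      moreover have "real (card U) / real n \<le> real (card (kill i S a))"
        using S(2) n by (simp add: divide_simps mult.commute flip: of_nat_mult)
      ultimately have "real (card ?U') \<le> real (card U) * (1 - 1 / real n)"
        by (simp add: algebra_simps)
      then have "real (card ?U') * (1 - 1 / real n) ^ r \<le>
          real (card U) * (1 - 1 / real n) * (1 - 1 / real n) ^ r"
        using n by (intro mult_right_mono) (auto simp: divide_simps)
      also have "\<dots> < 1" using Suc.prems(2) by (simp add: U_def n_def mult.assoc)
      finally show ?thesis
        unfolding d_def using Suc.prems(1) by (intro Suc.IH) (auto simp: D'_def n_def)
    next
      case True
      show ?thesis
      proof (rule solvable_output[of _ _ None])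
        fix v assume v: "v \<in> D'"
        have "(\<Sum>i\<in>N. val i (v i) (A i)) < t" if A: "A \<in> alloc N R" for A
        proof (rule ccontr)
          assume "\<not> ?thesis"
          then have t: "t \<le> (\<Sum>i\<in>N. val i (v i) (A i))" by simp
          define k where "k i = kill i (A i) (val i (v i) (A i))" for i
          have AR: "A i \<subseteq> R" if "i \<in> N" for i using A that by (auto simp: alloc_def)
          have "U \<subseteq> (\<Union>i\<in>N. k i)"
          proof
            fix x assume x: "x \<in> U"
            show "x \<in> (\<Union>i\<in>N. k i)"
            proof (rule ccontr)
              assume "x \<notin> (\<Union>i\<in>N. k i)"
              then have "L * val i (v i) (A i) \<le> snd x i + sum (fst x) (A i)" if "i \<in> N" for i
                using x that by (auto simp: k_def kill_def not_less)
              \<comment> \<open>Summed over disjoint bundles, the unviolated inequalities bound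
                \<open>L * t\<close> by the total of the certificate, which is less than
                \<open>L * t\<close>.\<close>
              then have "L * (\<Sum>i\<in>N. val i (v i) (A i)) \<le> (\<Sum>i\<in>N. snd x i + sum (fst x) (A i))"
                unfolding sum_distrib_left by (rule sum_mono)
              also have "\<dots> = sum (snd x) N + sum (fst x) (\<Union>i\<in>N. A i)"
              proof -
                have "sum (fst x) (\<Union>i\<in>N. A i) = (\<Sum>i\<in>N. sum (fst x) (A i))"
                  using A AR assms(1,2)
                  by (intro sum.UNION_disjoint) (auto simp: alloc_def disjoint_family_on_def intro: finite_subset)
                then show ?thesis by (simp add: sum.distrib)
              qed
              also have "\<dots> \<le> sum (snd x) N + sum (fst x) R"
                using AR assms(2) by (intro add_left_mono sum_mono2) auto
              also have "\<dots> < L * t"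
                using x by (auto simp: U_def certificates_def)
              finally show False using t by (meson mult_le_mono2 not_le)
            qed
          qed
          moreover have fk: "finite (k i)" for i using finU by (simp add: k_def kill_def)
          ultimately have "card U \<le> (\<Sum>i\<in>N. card (k i))"
            using card_UN_le[OF assms(1), of k] assms(1)
            by (meson card_mono finite_UN_I le_trans)
          then have "n * card U \<le> (\<Sum>i\<in>N. n * card (k i))"
            unfolding sum_distrib_left[symmetric] by (rule mult_le_mono2)
          \<comment> \<open>The sets \<open>k i\<close> cover \<open>U\<close>, yet silence means
            that each of the \<open>n\<close> holds less than \<open>card U / n\<close> of
            it.\<close>
          moreover have "(\<Sum>i\<in>N. n * card (k i)) < (\<Sum>i\<in>N. card U)"
          proof (rule sum_strict_mono[OF assms(1,3)])
            fix i assume i: "i \<in> N"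
            then have "g i (v i) = None" using True v by (auto simp: D'_def)
            then have "\<not> good i (v i) (A i)" by (auto simp: g_def split: if_splits)
            then show "n * card (k i) < card U" using AR[OF i] by (simp add: good_def k_def)
          qed
          ultimately show False by (simp add: n_def)
        qed
        then show "threshold_answer val N R t v None" by (simp add: threshold_answer_def)
      qed
    qed
    then show "solvable I d {v \<in> D. \<forall>i\<in>N. g i (v i) = h i} (threshold_answer val N R t)"
      by (simp add: D'_def)
  qed (use assms in auto)
  then show ?case by (simp add: d_def add.assoc)
qed

section \<open>Binary search and the cost of the subadditive auction\<close>

text \<open>The upper bound \<open>t\<close> on the optimum is output along with \<open>A\<close>,
  so that the results of different auctions can be compared without further communication.\<close>

definition half_optimal ::
    "(nat \<Rightarrow> 'x \<Rightarrow> 'a set \<Rightarrow> nat) \<Rightarrow> nat set \<Rightarrow> 'a set \<Rightarrow> (nat \<Rightarrow> 'x) \<Rightarrow>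
      (nat \<Rightarrow> 'a set) \<times> nat \<Rightarrow> bool" where
  "half_optimal val N R v = (\<lambda>(A, t). A \<in> alloc N R \<and> t \<le> 2 * (\<Sum>i\<in>N. val i (v i) (A i)) \<and>
     (\<forall>B\<in>alloc N R. (\<Sum>i\<in>N. val i (v i) (B i)) \<le> t))"

text \<open>Invariant: the optimum is below \<open>s + 2 ^ k\<close>, and the incumbent
  \<open>A\<close> has at least half of \<open>s\<close>. Either answer at the midpoint restores it
  with \<open>k\<close> reduced by one; at \<open>k = 0\<close> integrality turns
  \<open>< s + 1\<close> into \<open>\<le> s\<close>.\<close>

lemma solvable_binary_search:
  assumes step: "\<And>t D'. D' \<subseteq> D \<Longrightarrow> t \<le> T \<Longrightarrow> solvable I d D' (threshold_answer val N R t)"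
    and "D' \<subseteq> D" "s + 2 ^ k \<le> T"
    and "\<And>v. v \<in> D' \<Longrightarrow> A \<in> alloc N R \<and> s \<le> 2 * (\<Sum>i\<in>N. val i (v i) (A i)) \<and>
      (\<forall>B\<in>alloc N R. (\<Sum>i\<in>N. val i (v i) (B i)) < s + 2 ^ k)"
  shows "solvable I (k * d) D' (half_optimal val N R)"
  using assms(2-)
proof (induction k arbitrary: D' s A)
  case 0
  then show ?case
    by (intro solvable_output[of _ _ "(A, s)"]) (auto simp: half_optimal_def less_Suc_eq_le)
next
  case (Suc k)
  have "solvable I (d + k * d) D' (half_optimal val N R)"
  proof (rule solvable_bind)
    show "solvable I d D' (threshold_answer val N R (s + 2 ^ k))"
      using Suc.prems by (intro step) auto
    fix z
    show "solvable I (k * d) {v \<in> D'. threshold_answer val N R (s + 2 ^ k) v z} (half_optimal val N R)"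
    proof (cases z)
      case None
      then show ?thesis using Suc.prems
        by (intro Suc.IH[of _ s A]) (auto simp: threshold_answer_def)
    next
      case (Some B)
      then show ?thesis using Suc.prems
        by (intro Suc.IH[of _ "s + 2 ^ k" B]) (auto simp: threshold_answer_def mult_2 add.assoc)
    qed
  qed
  then show ?case by simp
qed

text \<open>By \<open>1 + x \<le> exp x\<close>, every \<open>n\<close> refutation rounds at least
  halve the number of certificates.\<close>

lemma power_one_minus_inverse_le:
  assumes "n > 0"
  shows "(1 - 1 / real n) ^ (n * k) \<le> (1 / 2) ^ k"
proof -
  have "(1 - 1 / real n) ^ n \<le> exp (- (1 / real n)) ^ n"
    using assms exp_ge_add_one_self[of "- (1 / real n)"] by (intro power_mono) (auto simp: divide_simps)
  also have "\<dots> = exp (- 1)"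
    using assms by (simp flip: exp_of_nat_mult)
  also have "\<dots> \<le> 1 / 2"
    using exp_ge_add_one_self[of 1] by (simp add: exp_minus divide_simps)
  finally show ?thesis
    unfolding power_mult using assms by (intro power_mono) (auto simp: divide_simps)
qed

text \<open>\<open>n + e\<close> steps of binary search. Each has
  \<open>n * ((2 + m + 2 * n + e) * (m + n) + 1)\<close> refutation rounds with \<open>n\<close>
  messages of \<open>m + e + 2\<close> bits, followed by \<open>m * n\<close> halvings with
  \<open>n\<close> messages of \<open>2 * (e + m + 2 * n + 5)\<close> bits.\<close>

definition auction_cost :: "nat \<Rightarrow> nat \<Rightarrow> nat \<Rightarrow> nat" where
  "auction_cost m n e = (n + e) *
     ((n * ((2 + m + 2 * n + e) * (m + n) + 1)) * (n * (m + e + 2)) +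
      m * n * (n * (2 * (e + m + 2 * n + 5))))"

lemma auction_cost_mono:
  "m \<le> m' \<Longrightarrow> n \<le> n' \<Longrightarrow> auction_cost m n e \<le> auction_cost m' n' e"
  unfolding auction_cost_def by (intro mult_mono add_mono) auto

lemma solvable_subadditive_auction:
  fixes val :: "nat \<Rightarrow> 'x \<Rightarrow> 'a set \<Rightarrow> nat"
  assumes "finite N" "finite R" "N \<subseteq> I" and M: "M \<le> 2 ^ e"
    and val: "\<And>v i. v \<in> D \<Longrightarrow> i \<in> N \<Longrightarrow> bounded_subadditive R M (val i (v i))"
  shows "solvable I (auction_cost (card R) (card N) e) D (half_optimal val N R)"
proof (cases "N = {}")
  case True
  then show ?thesis
    by (intro solvable_output[of _ _ "(\<lambda>_. undefined, 0)"])
      (auto simp: half_optimal_def alloc_def disjoint_family_on_def)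
next
  case False
  define n m g where "n = card N" and "m = card R" and "g = 2 + m + 2 * n + e"
  have n: "n > 0" using assms(1) False by (simp add: n_def card_gt_0_iff)
  have pow: "x \<le> 2 ^ x" for x :: nat by (simp add: less_imp_le)
  define L where "L = 4 * (card R + card N)"
  \<comment> \<open>Since \<open>L * t \<le> 2 ^ g\<close>, there are at most
    \<open>2 ^ (g * (m + n))\<close> certificates; one more halving than the exponent brings the
    count below 1.\<close>
  define r where "r = n * (g * (m + n) + 1)"
  define c c' where "c = m + e + 2" and "c' = 2 * (e + m + 2 * n + 5)"
  have LT: "L * 2 ^ (n + e) \<le> 2 ^ g"
  proof -
    have "L * 2 ^ (n + e) \<le> 4 * 2 ^ (m + n) * 2 ^ (n + e)"
      unfolding L_def m_def n_def by (intro mult_le_mono le_refl pow)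
    also have "\<dots> = 2 ^ g" by (simp add: g_def power_add mult_2)
    finally show ?thesis .
  qed
  have step: "solvable I (r * (n * c) + m * n * (n * c')) D' (threshold_answer val N R t)"
    if "D' \<subseteq> D" "t \<le> 2 ^ (n + e)" for t D'
    unfolding n_def m_def
  proof (rule solvable_threshold[where M = M and L = L])
    let ?U = "{x \<in> certificates N R L t. \<not> refuted val N R L D' x}"
    have "card ?U \<le> card (certificates N R L t)"
      using certificates_finite[OF assms(1,2)] by (intro card_mono) auto
    also have "\<dots> \<le> (L * t) ^ (m + n)"
      unfolding m_def n_def by (rule certificates_card[OF assms(1,2)])
    also have "\<dots> \<le> (2 ^ g) ^ (m + n)"
      using LT mult_le_mono2[OF that(2), of L] by (intro power_mono) linarith+
    finally have "card ?U \<le> 2 ^ (g * (m + n))" by (simp add: power_mult)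
    then have "real (card ?U) \<le> 2 ^ (g * (m + n))"
      by (simp only: of_nat_le_numeral_power_cancel_iff)
    moreover have "(1 - 1 / real n) ^ r \<le> (1 / 2) ^ (g * (m + n) + 1)"
      unfolding r_def by (rule power_one_minus_inverse_le[OF n])
    ultimately have "real (card ?U) * (1 - 1 / real n) ^ r \<le>
        2 ^ (g * (m + n)) * (1 / 2) ^ (g * (m + n) + 1)"
      using n by (intro mult_mono) (auto simp: divide_simps)
    also have "\<dots> < 1" by (simp add: power_one_over)
    finally show "real (card ?U) * (1 - 1 / real (card N)) ^ r < 1" by (simp add: n_def)
    have "2 ^ card R * (M + 1) + 1 \<le> 2 ^ m * (2 ^ e + 2 ^ e) + (2 ^ m * 2 ^ e + 2 ^ m * 2 ^ e :: nat)"
      using M unfolding m_def by (intro add_mono mult_le_mono trans_le_add1) auto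
    also have "\<dots> = 2 ^ c" by (simp add: c_def power_add)
    finally show "2 ^ card R * (M + 1) + 1 \<le> 2 ^ c" .
    have "m * n * n + 1 \<le> 2 ^ m * 2 ^ n * 2 ^ n + 2 ^ m * 2 ^ n * 2 ^ n"
      by (intro add_mono mult_le_mono pow) auto
    also have "\<dots> = 2 ^ (m + 2 * n + 1)" by (simp add: power_add mult_2)
    finally have "8 * M * (m * n * n + 1) + 1 \<le> 8 * 2 ^ e * 2 ^ (m + 2 * n + 1) + 8 * 2 ^ e * 2 ^ (m + 2 * n + 1)"
      using M by (intro add_mono mult_le_mono) auto
    also have "\<dots> = 2 ^ (e + m + 2 * n + 5)" by (simp add: power_add)
    finally show "(8 * M * (card R * card N * card N + 1) + 1)\<^sup>2 \<le> 2 ^ c'"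
      unfolding c'_def m_def[symmetric] n_def[symmetric]
      by (subst mult.commute, subst power_mult) (intro power_mono, auto)
  qed (use that assms False L_def in auto)
  have "solvable I ((n + e) * (r * (n * c) + m * n * (n * c'))) D (half_optimal val N R)"
  proof (rule solvable_binary_search[where T = "2 ^ (n + e)" and s = 0 and A = "\<lambda>i\<in>N. {}"])
    fix v assume v: "v \<in> D"
    have "(\<Sum>i\<in>N. val i (v i) (B i)) < 2 ^ (n + e)" if "B \<in> alloc N R" for B
    proof -
      have "(\<Sum>i\<in>N. val i (v i) (B i)) \<le> n * M"
        unfolding n_def using val[OF v] that
        by (intro sum_bounded_above[of N _ M, simplified]) (auto simp: bounded_subadditive_def alloc_def)
      also have "\<dots> \<le> n * 2 ^ e" using M by simp
      also have "\<dots> < 2 ^ n * 2 ^ e" by simp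
      finally show ?thesis by (simp add: power_add)
    qed
    then show "(\<lambda>i\<in>N. {}) \<in> alloc N R \<and> 0 \<le> 2 * (\<Sum>i\<in>N. val i (v i) ((\<lambda>i\<in>N. {}) i)) \<and>
      (\<forall>B\<in>alloc N R. (\<Sum>i\<in>N. val i (v i) (B i)) < 0 + 2 ^ (n + e))"
      by (auto simp: alloc_def disjoint_family_on_def)
  qed (use step in auto)
  then show ?thesis
    by (simp add: auction_cost_def r_def g_def c_def c'_def m_def n_def)
qed

section \<open>Single-minded bidders\<close>

text \<open>The score \<open>2 * sum w X + snd (a X)\<close> is at most twice the welfare of
  \<open>A\<close>, as \<open>snd (a X)\<close> is at most twice what \<open>J\<close> receives. For
  the single-minded winners \<open>Y\<close> of \<open>B\<close> the score is at least the welfare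
  of \<open>B\<close>, as \<open>snd (a Y)\<close> bounds what \<open>J\<close> can get outside
  their demands.\<close>

lemma half_optimal_combine:
  fixes u :: "nat \<Rightarrow> 'a set \<Rightarrow> nat"
  assumes fin: "finite I" "finite R" and "J \<subseteq> I"
    and T: "\<And>i. i \<in> I - J \<Longrightarrow> T i \<subseteq> R"
    and u: "\<And>i S. i \<in> I - J \<Longrightarrow> S \<subseteq> R \<Longrightarrow> u i S = (if T i \<subseteq> S then w i else 0)"
    and F: "F = {X. X \<subseteq> I - J \<and> disjoint_family_on T X}"
    and a: "\<And>X. X \<in> F \<Longrightarrow> half_optimal (\<lambda>i x. u i) J (R - (\<Union>i\<in>X. T i)) v (a X)"
    and X: "X \<in> F" and best: "\<And>Y. Y \<in> F \<Longrightarrow> 2 * sum w Y + snd (a Y) \<le> 2 * sum w X + snd (a X)"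
    and A: "A = (\<lambda>i\<in>I. if i \<in> X then T i else if i \<in> J then fst (a X) i else {})"
    and B: "B \<in> alloc I R"
  shows "A \<in> alloc I R" "(\<Sum>i\<in>I. u i (B i)) \<le> 2 * (\<Sum>i\<in>I. u i (A i))"
proof -
  have XI: "X \<subseteq> I - J" "disjoint_family_on T X" using X F by auto
  have aX: "fst (a X) \<in> alloc J (R - (\<Union>i\<in>X. T i))"
    "snd (a X) \<le> 2 * (\<Sum>i\<in>J. u i (fst (a X) i))"
    using a[OF X] by (auto simp: half_optimal_def case_prod_unfold)
  show "A \<in> alloc I R"
    using XI aX(1) T unfolding A alloc_def disjoint_family_on_def
    by (auto split: if_splits; blast)
  have lower: "sum w X + (\<Sum>i\<in>J. u i (fst (a X) i)) \<le> (\<Sum>i\<in>I. u i (A i))"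
  proof -
    have "(\<Sum>i\<in>X. u i (A i)) = sum w X"
    proof (rule sum.cong[OF refl])
      fix i assume "i \<in> X"
      then have "i \<in> I - J" "A i = T i" using XI by (auto simp: A)
      then show "u i (A i) = w i" using u[of i "T i"] T[of i] by simp
    qed
    moreover have "(\<Sum>i\<in>J. u i (A i)) = (\<Sum>i\<in>J. u i (fst (a X) i))"
      using XI \<open>J \<subseteq> I\<close> by (intro sum.cong refl) (auto simp: A)
    moreover have "(\<Sum>i\<in>X \<union> J. u i (A i)) = (\<Sum>i\<in>X. u i (A i)) + (\<Sum>i\<in>J. u i (A i))"
      using XI \<open>J \<subseteq> I\<close> fin by (intro sum.union_disjoint) (auto intro: finite_subset)
    moreover have "(\<Sum>i\<in>X \<union> J. u i (A i)) \<le> (\<Sum>i\<in>I. u i (A i))"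
      using XI \<open>J \<subseteq> I\<close> fin by (intro sum_mono2) auto
    ultimately show ?thesis by simp
  qed
  \<comment> \<open>Positive value forces \<open>T i \<subseteq> B i\<close>, so these demands are
    disjoint and \<open>Y\<close> is one of the guesses in \<open>F\<close>.\<close>
  define Y where "Y = {i \<in> I - J. 0 < u i (B i)}"
  have BR: "B i \<subseteq> R" if "i \<in> I" for i using B that by (auto simp: alloc_def)
  have YB: "T i \<subseteq> B i \<and> u i (B i) = w i" if "i \<in> Y" for i
    using that u[of i "B i"] BR[of i] by (auto simp: Y_def split: if_splits)
  have Bdisj: "B i \<inter> B j = {}" if "i \<in> I" "j \<in> I" "i \<noteq> j" for i j
    using B that by (auto simp: alloc_def disjoint_family_on_def)
  have Y: "Y \<in> F"
  proof -
    have "T i \<inter> T j = {}" if "i \<in> Y" "j \<in> Y" "i \<noteq> j" for i j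
      using YB[OF that(1)] YB[OF that(2)] Bdisj[of i j] that by (auto simp: Y_def)
    then show ?thesis by (simp add: F disjoint_family_on_def) (auto simp: Y_def)
  qed
  have "restrict B J \<in> alloc J (R - (\<Union>i\<in>Y. T i))"
  proof -
    have "B j \<inter> T i = {}" if "j \<in> J" "i \<in> Y" for i j
    proof -
      have "B j \<inter> B i = {}" using that \<open>J \<subseteq> I\<close> by (intro Bdisj) (auto simp: Y_def)
      then show ?thesis using YB[OF that(2)] by blast
    qed
    then have "restrict B J \<in> J \<rightarrow>\<^sub>E Pow (R - (\<Union>i\<in>Y. T i))"
      using BR \<open>J \<subseteq> I\<close> by (intro restrict_PiE_iff[THEN iffD2]) blast
    moreover have "disjoint_family_on (restrict B J) J"
      using Bdisj \<open>J \<subseteq> I\<close> by (simp add: disjoint_family_on_def subset_iff)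
    ultimately show ?thesis by (simp add: alloc_def)
  qed
  then have "(\<Sum>i\<in>J. u i (restrict B J i)) \<le> snd (a Y)"
    using a[OF Y] by (auto simp: half_optimal_def case_prod_unfold)
  moreover have "(\<Sum>i\<in>J. u i (restrict B J i)) = (\<Sum>i\<in>J. u i (B i))"
    by (intro sum.cong) auto
  moreover have "(\<Sum>i\<in>I - J. u i (B i)) = sum w Y"
    using fin YB by (intro sum.mono_neutral_cong_right) (auto simp: Y_def)
  moreover have "(\<Sum>i\<in>I. u i (B i)) = (\<Sum>i\<in>I - J. u i (B i)) + (\<Sum>i\<in>J. u i (B i))"
    using fin(1) \<open>J \<subseteq> I\<close> by (metis sum.subset_diff)
  ultimately have "(\<Sum>i\<in>I. u i (B i)) \<le> 2 * sum w Y + snd (a Y)" by linarith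
  also have "\<dots> \<le> 2 * sum w X + snd (a X)" by (rule best[OF Y])
  also have "\<dots> \<le> 2 * (\<Sum>i\<in>I. u i (A i))" using lower aX(2) by linarith
  finally show "(\<Sum>i\<in>I. u i (B i)) \<le> 2 * (\<Sum>i\<in>I. u i (A i))" .
qed

section \<open>From precision \<open>k\<close> to integer values\<close>

text \<open>The floor is exact on values of precision \<open>k\<close>; this is the source of the
  integrality that absorbs all rounding errors.\<close>

definition scaled :: "nat \<Rightarrow> valuation \<Rightarrow> nat set \<Rightarrow> nat" where
  "scaled k v S = nat \<lfloor>2 ^ k * v S\<rfloor>"

lemma scaled:
  assumes "has_precision m k v" "S \<subseteq> items m"
  shows "real (scaled k v S) = 2 ^ k * v S" "scaled k v S \<le> 2 ^ (2 * k)"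
proof -
  have "v S = 0 \<or> (\<exists>x\<in>{1..2 ^ (2 * k)}. v S = real x / 2 ^ k)"
    using assms by (auto simp: has_precision_def)
  then obtain x :: nat where "x \<le> 2 ^ (2 * k)" "2 ^ k * v S = real x" by force
  then show "real (scaled k v S) = 2 ^ k * v S" "scaled k v S \<le> 2 ^ (2 * k)"
    by (simp_all add: scaled_def)
qed

lemma bounded_subadditive_scaled:
  assumes "is_valuation m v" "has_precision m k v" "subadditive m v" "R \<subseteq> items m"
  shows "bounded_subadditive R (2 ^ (2 * k)) (scaled k v)"
proof -
  have eq: "real (scaled k v S) = 2 ^ k * v S" if "S \<subseteq> R" for S
    using scaled(1)[OF assms(2)] that assms(4) by blast
  have "real (scaled k v S) \<le> real (scaled k v T)" if "S \<subseteq> T" "T \<subseteq> R" for S T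
  proof -
    have "S \<in> Pow (items m)" "T \<in> Pow (items m)" using that assms(4) by blast+
    then have "v S \<le> v T" using assms(1) that(1) unfolding is_valuation_def by (blast intro: mono_onD)
    then show ?thesis using eq[of S] eq[of T] that by simp
  qed
  moreover have "real (scaled k v (S \<union> T)) \<le> real (scaled k v S) + real (scaled k v T)" if "S \<subseteq> R" "T \<subseteq> R" for S T
  proof -
    have "2 ^ k * v (S \<union> T) \<le> 2 ^ k * (v S + v T)"
      using that assms(3,4) by (intro mult_left_mono) (auto simp: subadditive_def)
    then show ?thesis using eq[of S] eq[of T] eq[of "S \<union> T"] that by (simp add: distrib_left)
  qed
  moreover have "real (scaled k v {}) = 0"
    using assms(1) eq[of "{}"] by (simp add: is_valuation_def)
  ultimately have "subadditive_valuation R (\<lambda>S. real (scaled k v S))"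
    by (simp add: subadditive_valuation_def)
  moreover have "scaled k v S \<le> 2 ^ (2 * k)" if "S \<subseteq> R" for S
    using scaled(2)[OF assms(2)] that assms(4) by blast
  ultimately show ?thesis by (simp add: bounded_subadditive_def)
qed

definition single_minded_valuations :: "nat \<Rightarrow> nat \<Rightarrow> valuation set" where
  "single_minded_valuations m k = {v. is_valuation m v \<and> has_precision m k v \<and> single_minded m v}"

text \<open>Such a valuation is determined by its demand \<open>T\<close>, a subset of the items,
  and by \<open>v T\<close>, which after scaling is an integer in
  \<open>{..2 ^ (2 * k)}\<close>.\<close>

lemma finite_single_minded_valuations: "finite (single_minded_valuations m k)"
  and card_single_minded_valuations:
    "card (single_minded_valuations m k) \<le> 2 ^ m * (2 ^ (2 * k) + 1)"
proof -
  define f where "f = (\<lambda>(T, x). \<lambda>S\<in>Pow (items m). if T \<subseteq> S then real x / 2 ^ k else 0)"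
  let ?P = "Pow (items m) \<times> {..2 ^ (2 * k) :: nat}"
  have sub: "single_minded_valuations m k \<subseteq> f ` ?P"
  proof
    fix v assume "v \<in> single_minded_valuations m k"
    then have v: "is_valuation m v" "has_precision m k v" "single_minded m v"
      by (auto simp: single_minded_valuations_def)
    obtain w T where T: "T \<subseteq> items m" "\<And>S. S \<subseteq> items m \<Longrightarrow> v S = (if T \<subseteq> S then w else 0)"
      using v(3) by (auto simp: single_minded_def)
    have "v = f (T, scaled k v T)"
    proof (rule extensionalityI[of _ "Pow (items m)"])
      show "v \<in> extensional (Pow (items m))" using v(1) by (simp add: is_valuation_def)
      show "v S = f (T, scaled k v T) S" if "S \<in> Pow (items m)" for S
        using that T(2)[of S] T(2)[OF T(1)] scaled(1)[OF v(2) T(1)] by (simp add: f_def)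
    qed (simp add: f_def)
    moreover have "(T, scaled k v T) \<in> ?P" using T(1) scaled(2)[OF v(2) T(1)] by simp
    ultimately show "v \<in> f ` ?P" by blast
  qed
  then show "finite (single_minded_valuations m k)" by (rule finite_subset) simp
  have "card (single_minded_valuations m k) \<le> card ?P"
    by (rule surj_card_le[OF _ sub]) simp
  then show "card (single_minded_valuations m k) \<le> 2 ^ m * (2 ^ (2 * k) + 1)"
    by (simp add: card_cartesian_product card_Pow)
qed

lemma allocations_eq: "allocations n m = alloc (bidders n) (items m)"
  by (simp add: allocations_def alloc_def)

lemma welfare_scaled:
  assumes "v \<in> profiles n (subadditive_or_single_minded m k)" "A \<in> allocations n m"
  shows "2 ^ k * welfare n v A = real (\<Sum>i\<in>bidders n. scaled k (v i) (A i))"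
proof -
  have "real (scaled k (v i) (A i)) = 2 ^ k * v i (A i)" if "i \<in> bidders n" for i
    using assms that
    by (intro scaled(1)[of m]) (auto simp: profiles_def subadditive_or_single_minded_def allocations_def)
  then show ?thesis by (simp add: welfare_def sum_distrib_left)
qed

lemma half_opt_welfareI:
  assumes v: "v \<in> profiles n (subadditive_or_single_minded m k)" and A: "A \<in> allocations n m"
    and le: "\<And>B. B \<in> allocations n m \<Longrightarrow>
      (\<Sum>i\<in>bidders n. scaled k (v i) (B i)) \<le> 2 * (\<Sum>i\<in>bidders n. scaled k (v i) (A i))"
  shows "1 / 2 * opt_welfare n m v \<le> welfare n v A"
proof -
  have "opt_welfare n m v \<le> 2 * welfare n v A"
    unfolding opt_welfare_def
  proof (rule Max.boundedI)
    show "finite (welfare n v ` allocations n m)" by (simp add: allocations_eq finite_alloc)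
    show "welfare n v ` allocations n m \<noteq> {}" using A by blast
    fix x assume "x \<in> welfare n v ` allocations n m"
    then obtain B where B: "B \<in> allocations n m" "x = welfare n v B" by blast
    have "real (\<Sum>i\<in>bidders n. scaled k (v i) (B i)) \<le>
        real (2 * (\<Sum>i\<in>bidders n. scaled k (v i) (A i)))"
      using le[OF B(1)] by (simp only: of_nat_le_iff)
    then have "2 ^ k * welfare n v B \<le> 2 ^ k * (2 * welfare n v A)"
      unfolding of_nat_mult welfare_scaled[OF v A, symmetric] welfare_scaled[OF v B(1), symmetric]
      by simp
    then show "x \<le> 2 * welfare n v A" using B(2) by simp
  qed
  then show ?thesis by simp
qed

definition half_optimal_allocation ::
    "nat \<Rightarrow> nat \<Rightarrow> (nat \<Rightarrow> valuation) \<Rightarrow> (nat \<Rightarrow> nat set) \<Rightarrow> bool" where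
  "half_optimal_allocation n m v A \<longleftrightarrow>
     A \<in> allocations n m \<and> 1 / 2 * opt_welfare n m v \<le> welfare n v A"

text \<open>For each guess \<open>X\<close> of winning single-minded bidders with disjoint demands,
  the bidders in \<open>J\<close> run an auction for the remaining items. Its results and the
  weights are public, so picking the guess of best score is free.\<close>

lemma solvable_known_single_minded:
  assumes D: "D \<subseteq> profiles n (subadditive_or_single_minded m k)" and J: "J \<subseteq> bidders n"
    and sub: "\<And>v i. v \<in> D \<Longrightarrow> i \<in> J \<Longrightarrow> subadditive m (v i)"
    and known: "\<And>v i. v \<in> D \<Longrightarrow> i \<in> bidders n - J \<Longrightarrow> v i = s i"
    and s: "\<And>i. i \<in> bidders n - J \<Longrightarrow> s i \<in> single_minded_valuations m k"
  shows "solvable (bidders n) (2 ^ n * auction_cost m n (2 * k)) D (half_optimal_allocation n m)"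
proof -
  define val where "val = (\<lambda>(i::nat) x. scaled k x)"
  have "\<forall>i\<in>bidders n - J. \<exists>T. T \<subseteq> items m \<and>
      (\<forall>S\<subseteq>items m. scaled k (s i) S = (if T \<subseteq> S then scaled k (s i) T else 0))"
  proof
    fix i assume "i \<in> bidders n - J"
    then have "single_minded m (s i)" using s by (auto simp: single_minded_valuations_def)
    then obtain w T where "T \<subseteq> items m" "\<And>S. S \<subseteq> items m \<Longrightarrow> s i S = (if T \<subseteq> S then w else 0)"
      by (auto simp: single_minded_def)
    then show "\<exists>T. T \<subseteq> items m \<and>
      (\<forall>S\<subseteq>items m. scaled k (s i) S = (if T \<subseteq> S then scaled k (s i) T else 0))"
      by (intro exI[of _ T]) (simp add: scaled_def)
  qed
  then obtain T where T: "\<And>i. i \<in> bidders n - J \<Longrightarrow> T i \<subseteq> items m"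
    "\<And>i S. i \<in> bidders n - J \<Longrightarrow> S \<subseteq> items m \<Longrightarrow>
      scaled k (s i) S = (if T i \<subseteq> S then scaled k (s i) (T i) else 0)"
    by metis
  define F where "F = {X. X \<subseteq> bidders n - J \<and> disjoint_family_on T X}"
  define R where "R X = items m - (\<Union>i\<in>X. T i)" for X
  define w where "w i = scaled k (s i) (T i)" for i
  have F_sub: "F \<subseteq> Pow (bidders n)" by (auto simp: F_def)
  have finF: "finite F" by (rule finite_subset[OF F_sub]) simp
  have "card F \<le> card (Pow (bidders n))" by (rule card_mono[OF _ F_sub]) simp
  then have cardF: "card F \<le> 2 ^ n" by (simp add: card_Pow)
  have memD: "is_valuation m (v i) \<and> has_precision m k (v i)" if "v \<in> D" "i \<in> bidders n" for v i
  proof -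
    have "v i \<in> subadditive_or_single_minded m k"
      using D that unfolding profiles_def by (blast intro: PiE_mem)
    then show ?thesis by (simp add: subadditive_or_single_minded_def)
  qed
  have one: "solvable (bidders n) (auction_cost m n (2 * k)) D (half_optimal val J (R X))" for X
  proof -
    have "solvable (bidders n) (auction_cost (card (R X)) (card J) (2 * k)) D (half_optimal val J (R X))"
    proof (rule solvable_subadditive_auction)
      show "bounded_subadditive (R X) (2 ^ (2 * k)) (val i (v i))" if "v \<in> D" "i \<in> J" for v i
        unfolding val_def using that memD[of v i] sub J
        by (intro bounded_subadditive_scaled[of m]) (auto simp: R_def)
    qed (use J in \<open>auto simp: R_def intro: finite_subset\<close>)
    moreover have "card (R X) \<le> m" "card J \<le> n"
      using card_mono[of "items m" "R X"] card_mono[OF _ J] by (auto simp: R_def)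
    ultimately show ?thesis by (elim solvable_mono) (auto intro: auction_cost_mono)
  qed
  define score where "score a X = 2 * sum w X + snd (a X)"
    for a :: "nat set \<Rightarrow> (nat \<Rightarrow> nat set) \<times> nat" and X
  define best where "best a = (SOME X. X \<in> F \<and> (\<forall>Y\<in>F. score a Y \<le> score a X))" for a
  have best: "best a \<in> F \<and> (\<forall>Y\<in>F. score a Y \<le> score a (best a))" for a
    unfolding best_def
  proof (rule someI_ex)
    have "{} \<in> F" by (simp add: F_def disjoint_family_on_def)
    then have "Max (score a ` F) \<in> score a ` F" using finF by (intro Max_in) auto
    then obtain X where "X \<in> F" "score a X = Max (score a ` F)" by force
    then show "\<exists>X. X \<in> F \<and> (\<forall>Y\<in>F. score a Y \<le> score a X)" using finF by auto
  qed
  have "solvable (bidders n) (card F * auction_cost m n (2 * k)) D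
      (\<lambda>v a. \<forall>X\<in>F. half_optimal val J (R X) v (a X))"
    by (rule solvable_family[OF finF one])
  then have "solvable (bidders n) (2 ^ n * auction_cost m n (2 * k)) D
      (\<lambda>v a. \<forall>X\<in>F. half_optimal val J (R X) v (a X))"
    by (rule solvable_mono) (use cardF in auto)
  then show ?thesis
  proof (rule solvable_map[where f = "\<lambda>a. \<lambda>i\<in>bidders n.
      if i \<in> best a then T i else if i \<in> J then fst (a (best a)) i else {}"])
    fix v a assume v: "v \<in> D" and a: "\<forall>X\<in>F. half_optimal val J (R X) v (a X)"
    let ?A = "\<lambda>i\<in>bidders n. if i \<in> best a then T i else if i \<in> J then fst (a (best a)) i else {}"
    define u where "u i = scaled k (v i)" for i
    have comb: "?A \<in> alloc (bidders n) (items m)"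
      "(\<Sum>i\<in>bidders n. u i (B i)) \<le> 2 * (\<Sum>i\<in>bidders n. u i (?A i))"
      if "B \<in> alloc (bidders n) (items m)" for B
    proof -
      have a': "half_optimal (\<lambda>i x. u i) J (items m - (\<Union>i\<in>X. T i)) v (a X)" if "X \<in> F" for X
        using a that by (auto simp: half_optimal_def val_def u_def R_def)
      have u': "u i S = (if T i \<subseteq> S then w i else 0)" if "i \<in> bidders n - J" "S \<subseteq> items m" for i S
        unfolding u_def w_def known[OF v that(1)] by (rule T(2)[OF that])
      show "?A \<in> alloc (bidders n) (items m)"
        "(\<Sum>i\<in>bidders n. u i (B i)) \<le> 2 * (\<Sum>i\<in>bidders n. u i (?A i))"
        using half_optimal_combine[OF _ _ J T(1) u' F_def a' _ _ refl that, of "best a"] best[of a]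
        by (auto simp: score_def)
    qed
    \<comment> \<open>\<open>comb\<close> refers to a comparison allocation; any one serves to
      conclude that \<open>?A\<close> is an allocation.\<close>
    obtain B where "B \<in> alloc (bidders n) (items m)" using alloc_nonempty by blast
    then have A: "?A \<in> allocations n m" unfolding allocations_eq by (rule comb(1))
    have "1 / 2 * opt_welfare n m v \<le> welfare n v ?A"
      using D v A comb(2) by (intro half_opt_welfareI[where k = k]) (auto simp: allocations_eq u_def)
    then show "half_optimal_allocation n m v ?A" using A by (simp add: half_optimal_allocation_def)
  qed
qed

text \<open>A bidder who is not subadditive is single-minded and announces her whole valuation in
  \<open>m + 2 * k + 2\<close> bits; \<open>None\<close> marks the others. A bidder of both kinds is
  treated as subadditive.\<close>

lemma solvable_auction:
  "solvable (bidders n) (n * (m + 2 * k + 2) + 2 ^ n * auction_cost m n (2 * k))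
     (profiles n (subadditive_or_single_minded m k)) (half_optimal_allocation n m)"
proof -
  let ?D = "profiles n (subadditive_or_single_minded m k)"
  let ?B = "insert None (Some ` single_minded_valuations m k)"
  define g where "g x = (if subadditive m x then None else Some x)" for x :: valuation
  have "solvable (bidders n) (card (bidders n) * (m + 2 * k + 2) + 2 ^ n * auction_cost m n (2 * k))
     ?D (half_optimal_allocation n m)"
  proof (rule solvable_announce_all[where g = "\<lambda>_. g" and B = ?B])
    have "card ?B \<le> Suc (card (Some ` single_minded_valuations m k))"
      by (rule card_insert_le_m1) auto
    also have "\<dots> \<le> 2 ^ m * (2 ^ (2 * k) + 1) + 1"
      using card_single_minded_valuations[of m k] by (simp add: card_image)
    also have "\<dots> \<le> 2 ^ m * (2 ^ (2 * k) + 2 ^ (2 * k)) + 2 ^ m * (2 ^ (2 * k) + 2 ^ (2 * k))"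
      by (intro add_mono mult_le_mono) (auto intro: trans_le_add1)
    also have "\<dots> = 2 ^ (m + 2 * k + 2)" by (simp add: power_add algebra_simps)
    finally show "card ?B \<le> 2 ^ (m + 2 * k + 2)" .
    show "g (v i) \<in> ?B" if "v \<in> ?D" "i \<in> bidders n" for v i
      using that
      by (auto simp: g_def profiles_def subadditive_or_single_minded_def single_minded_valuations_def Pi_def)
    fix h :: "nat \<Rightarrow> valuation option"
    let ?D' = "{v \<in> ?D. \<forall>i\<in>bidders n. g (v i) = h i}"
    define J where "J = {i \<in> bidders n. h i = None}"
    show "solvable (bidders n) (2 ^ n * auction_cost m n (2 * k)) ?D' (half_optimal_allocation n m)"
    proof (cases "?D' = {}")
      case False
      then obtain v0 where v0: "v0 \<in> ?D'" by blast
      have known: "v i = the (h i) \<and> \<not> subadditive m (v i)" if "v \<in> ?D'" "i \<in> bidders n - J" for v i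
      proof -
        have "g (v i) = h i" "h i \<noteq> None" using that by (auto simp: J_def)
        then show ?thesis by (auto simp: g_def split: if_splits)
      qed
      show ?thesis
      proof (rule solvable_known_single_minded[where J = J and s = "\<lambda>i. the (h i)"])
        show "subadditive m (v i)" if "v \<in> ?D'" "i \<in> J" for v i
        proof -
          have "g (v i) = None" using that by (auto simp: J_def)
          then show ?thesis by (simp add: g_def split: if_splits)
        qed
        show "the (h i) \<in> single_minded_valuations m k" if "i \<in> bidders n - J" for i
        proof -
          have "v0 i \<in> subadditive_or_single_minded m k"
            using v0 that by (auto simp: profiles_def)
          then show ?thesis using known[OF v0 that]
            by (auto simp: subadditive_or_single_minded_def single_minded_valuations_def)
        qed
        show "v i = the (h i)" if "v \<in> ?D'" "i \<in> bidders n - J" for v i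
          using known[OF that] by blast
        show "?D' \<subseteq> ?D" "J \<subseteq> bidders n" unfolding J_def by blast+
      qed
    next
      case True
      then show ?thesis by (simp only: solvable_empty)
    qed
  qed (simp_all add: finite_single_minded_valuations)
  then show ?thesis by simp
qed

section \<open>The polynomial cost bound\<close>

text \<open>\<open>cost\<close> is a \<open>Max\<close>, which is meaningful only over a finite
  nonempty set of profiles.\<close>

lemma finite_profiles: "finite (profiles n (subadditive_or_single_minded m k))"
proof -
  let ?V = "{0} \<union> {real x / 2 ^ k | x. x \<in> {1..2 ^ (2 * k) :: nat}}"
  have "finite ?V" by simp
  then have "finite (Pow (items m) \<rightarrow>\<^sub>E ?V)" by (intro finite_PiE) simp_all
  moreover have "subadditive_or_single_minded m k \<subseteq> Pow (items m) \<rightarrow>\<^sub>E ?V"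
    unfolding subadditive_or_single_minded_def has_precision_def is_valuation_def PiE_def by blast
  ultimately have "finite (subadditive_or_single_minded m k)" by (rule finite_subset[rotated])
  then show ?thesis unfolding profiles_def by (intro finite_PiE) simp_all
qed

lemma profiles_nonempty: "profiles n (subadditive_or_single_minded m k) \<noteq> {}"
proof -
  define z :: valuation where "z = (\<lambda>S\<in>Pow (items m). 0)"
  have "z \<in> subadditive_or_single_minded m k"
    by (auto simp: z_def subadditive_or_single_minded_def is_valuation_def has_precision_def
        subadditive_def mono_on_def)
  then have "(\<lambda>i\<in>bidders n. z) \<in> profiles n (subadditive_or_single_minded m k)"
    by (auto simp: profiles_def)
  then show ?thesis by blast
qed

text \<open>With every quantity bounded by a multiple of \<open>s\<close>, the announcements
  contribute \<open>3 * s ^ 6\<close> and each auction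
  \<open>2 * s * (12 * s ^ 5 + 8 * s ^ 5)\<close>, that is \<open>40 * s ^ 6\<close>; hence the
  constant 43.\<close>

lemma total_cost_le:
  assumes "m \<ge> 2" "n \<ge> 1" "k \<ge> 1" and s: "s = m + n + k"
  shows "n * (m + 2 * k + 2) + 2 ^ n * auction_cost m n (2 * k) \<le> 43 * 2 ^ n * s ^ 6"
proof -
  have s1: "1 \<le> s" using assms by simp
  have "(2 + m + 2 * n + 2 * k) * (m + n) + 1 \<le> 3 * s * s + s * s"
    using assms s1 by (intro add_mono mult_le_mono) auto
  then have "n * ((2 + m + 2 * n + 2 * k) * (m + n) + 1) \<le> s * (3 * s * s + s * s)"
    using assms by (intro mult_le_mono) auto
  moreover have p0: "n * (m + 2 * k + 2) \<le> s * (3 * s)"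
    using assms by (intro mult_le_mono) auto
  ultimately have "n * ((2 + m + 2 * n + 2 * k) * (m + n) + 1) * (n * (m + 2 * k + 2)) \<le>
      s * (3 * s * s + s * s) * (s * (3 * s))"
    by (rule mult_le_mono)
  also have "\<dots> = 12 * s ^ 5" by (simp add: power_numeral_reduce)
  finally have p1: "n * ((2 + m + 2 * n + 2 * k) * (m + n) + 1) * (n * (m + 2 * k + 2)) \<le> 12 * s ^ 5" .
  have "m * n * (n * (2 * (2 * k + m + 2 * n + 5))) \<le> s * s * (s * (2 * (4 * s)))"
    using assms by (intro mult_le_mono) auto
  also have "\<dots> \<le> s * s * (s * (2 * (4 * s))) * s" using s1 by simp
  finally have p2: "m * n * (n * (2 * (2 * k + m + 2 * n + 5))) \<le> 8 * s ^ 5"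
    by (simp add: power_numeral_reduce)
  have "auction_cost m n (2 * k) \<le> (2 * s) * (12 * s ^ 5 + 8 * s ^ 5)"
    unfolding auction_cost_def
    by (intro mult_le_mono add_mono p1 p2) (simp add: s)
  also have "\<dots> = 40 * s ^ 6" by (simp add: power_numeral_reduce)
  finally have c: "2 ^ n * auction_cost m n (2 * k) \<le> 2 ^ n * (40 * s ^ 6)" by simp
  have "n * (m + 2 * k + 2) \<le> 1 * (s * (3 * s) * 1)"
    using p0 by simp
  also have "\<dots> \<le> 2 ^ n * (s * (3 * s) * s ^ 4)"
    using s1 by (intro mult_le_mono le_refl one_le_power) auto
  also have "\<dots> = 2 ^ n * (3 * s ^ 6)" by (simp add: power_numeral_reduce)
  finally have "n * (m + 2 * k + 2) + 2 ^ n * auction_cost m n (2 * k) \<le>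
      2 ^ n * (3 * s ^ 6) + 2 ^ n * (40 * s ^ 6)" using c by (rule add_mono)
  then show ?thesis by (simp add: mult.commute mult.left_commute)
qed

theorem corollary4p3:
  fixes C :: real
  assumes "C > 0"
  shows "\<exists>q :: real poly poly. \<forall>m k n :: nat.
    m \<ge> 2 \<longrightarrow> k \<ge> 1 \<longrightarrow> n \<ge> 1 \<longrightarrow> real n \<le> C * log 2 (real m) \<longrightarrow>
    (\<exists>P :: (valuation, nat \<Rightarrow> nat set) protocol.
       speakers P \<subseteq> bidders n \<and>
       real (cost P (profiles n (subadditive_or_single_minded m k))) \<le> eval2 q (real m) (real k) \<and>
       half_approximates n m P (profiles n (subadditive_or_single_minded m k)))"
proof -
  define c where "c = nat \<lceil>C\<rceil>"
  \<comment> \<open>\<open>[:[:0, 1:]:]\<close> evaluates to \<open>m\<close> and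
    \<open>[:[:0, 1:], 1:]\<close> to \<open>m + k\<close>. From \<open>n \<le> c * log 2 m\<close>
    follow \<open>2 ^ n \<le> m ^ c\<close> and, as \<open>log 2 m \<le> m\<close>, also
    \<open>m + n + k \<le> (c + 1) * (m + k)\<close>.\<close>
  define q :: "real poly poly" where
    "q = [:[:43 * (real c + 1) ^ 6:]:] * [:[:0, 1:]:] ^ c * [:[:0, 1:], 1:] ^ 6"
  have eval_q: "eval2 q x y = 43 * (real c + 1) ^ 6 * x ^ c * (x + y) ^ 6" for x y
    by (simp add: q_def eval2_def add.commute)
  show ?thesis
  proof (intro exI[of _ q] allI impI)
    fix m k n :: nat
    assume mkn: "m \<ge> 2" "k \<ge> 1" "n \<ge> 1" and n: "real n \<le> C * log 2 (real m)"
    let ?D = "profiles n (subadditive_or_single_minded m k)"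
    define d where "d = n * (m + 2 * k + 2) + 2 ^ n * auction_cost m n (2 * k)"
    obtain P :: "(valuation, nat \<Rightarrow> nat set) protocol" where P: "speakers P \<subseteq> bidders n"
      "\<And>v. v \<in> ?D \<Longrightarrow> length (transcript P v) \<le> d \<and> half_optimal_allocation n m v (outcome P v)"
      using solvable_auction[of n m k] unfolding solvable_def d_def by blast
    have "cost P ?D \<le> d"
      unfolding cost_def using finite_profiles profiles_nonempty P(2)
      by (intro Max.boundedI) auto
    also have "d \<le> 43 * 2 ^ n * (m + n + k) ^ 6"
      unfolding d_def using mkn by (intro total_cost_le) auto
    finally have "real (cost P ?D) \<le> real (43 * 2 ^ n * (m + n + k) ^ 6)"
      by (simp only: of_nat_le_iff)
    also have "\<dots> = 43 * 2 ^ n * (real m + real n + real k) ^ 6" by simp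
    also have "\<dots> \<le> 43 * real m ^ c * ((real c + 1) * (real m + real k)) ^ 6"
    proof (intro mult_mono power_mono)
      have Cc: "C \<le> real c" unfolding c_def by linarith
      have log0: "0 \<le> log 2 (real m)" using mkn by simp
      have nc: "real n \<le> real c * log 2 (real m)"
        using n mult_right_mono[OF Cc log0] by linarith
      have "2 ^ n = 2 powr real n" by (simp add: powr_realpow)
      also have "\<dots> \<le> 2 powr (real c * log 2 (real m))" using nc by simp
      also have "\<dots> = (2 powr log 2 (real m)) powr real c"
        by (simp only: powr_powr mult.commute)
      also have "\<dots> = real m ^ c"
        using mkn by (simp add: powr_realpow)
      finally show "2 ^ n \<le> real m ^ c" .
      have "log 2 (real m) \<le> real m"
        using log2_of_power_le[of m m] mkn by (simp add: less_imp_le)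
      then have "real n \<le> real c * real m"
        using nc mult_left_mono[of "log 2 (real m)" "real m" "real c"] by linarith
      moreover have "0 \<le> real c * real k" by simp
      moreover have "(real c + 1) * (real m + real k) =
          real c * real m + real c * real k + real m + real k" by (simp add: algebra_simps)
      ultimately show "real m + real n + real k \<le> (real c + 1) * (real m + real k)"
        by linarith
    qed auto
    also have "\<dots> = eval2 q (real m) (real k)"
      by (simp add: eval_q power_mult_distrib)
    finally show "\<exists>P :: (valuation, nat \<Rightarrow> nat set) protocol.
       speakers P \<subseteq> bidders n \<and>
       real (cost P ?D) \<le> eval2 q (real m) (real k) \<and> half_approximates n m P ?D"
      using P by (intro exI[of _ P]) (auto simp: half_approximates_def half_optimal_allocation_def)
  qed
qed

end
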